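(* Let $A_1$ and $A_2$ be unital $C^*$-algebras and let $\phi\colon A_{1+}^{-1}\to A_{2+}^{-1}$ be a surjection. Then the following are equivalent: (i) there exists a Jordan $*$-isomorphism $J\colon A_1\to A_2$ such that $\phi(x)=\phi(e)^{1/2}J(x)\phi(e)^{1/2}$ for all $x\in A_{1+}^{-1}$; (ii) $\|\phi(x)\phi(y)^{-1}\|_S=\|xy^{-1}\|_S$ for all $x,y\in A_{1+}^{-1}$; (iii) $\sigma(\phi(x)\phi(y)^{-1})=\sigma(xy^{-1})$ for all $x,y\in A_{1+}^{-1}$.
   Context: For a unital $C^*$-algebra $A$ (unit always denoted $e$), $A_+^{-1}$ denotes the positive definite cone of $A$, i.e. the set of all positive invertible elements of $A$; $A_{j+}^{-1}$ denotes this cone for $A=A_j$. $\sigma(a)$ is the spectrum of $a\in A$, and $\|a\|_S=\sup\{|t|\colon t\in\sigma(a)\}$ is the spectral seminorm. A Jordan $*$-isomorphism $J\colon A_1\to A_2$ is a complex linear bijection that preserves the Jordan product $(ab+ba)/2$ and the involution. *)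

theory Defs
  imports "HOL-Analysis.Analysis"
begin

text \<open>
  Unital complex \<open>C\<^sup>*\<close>-algebras as a type class. The classes \<open>real_normed_algebra_1\<close> and \<open>banach\<close>
  provide a complete submultiplicative norm on a real unital algebra with \<open>1 \<noteq> 0\<close> and \<open>norm 1 = 1\<close>
  (the latter follows from the \<open>C\<^sup>*\<close>-identity when \<open>1 \<noteq> 0\<close>). The operation \<open>scaleC\<close> extends the real
  scalar multiplication of these classes to the complex numbers.
\<close>

class unital_cstar_algebra = real_normed_algebra_1 + banach +
  fixes scaleC :: "complex \<Rightarrow> 'a \<Rightarrow> 'a"  (infixr "*\<^sub>C" 75)
    and star :: "'a \<Rightarrow> 'a"
  assumes scaleC_add_right: "c *\<^sub>C (x + y) = c *\<^sub>C x + c *\<^sub>C y"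
    and scaleC_add_left: "(c + d) *\<^sub>C x = c *\<^sub>C x + d *\<^sub>C x"
    and scaleC_scaleC: "c *\<^sub>C (d *\<^sub>C x) = (c * d) *\<^sub>C x"
    and scaleC_of_real: "complex_of_real r *\<^sub>C x = r *\<^sub>R x"
    and norm_scaleC: "norm (c *\<^sub>C x) = cmod c * norm x"
    and mult_scaleC_left: "(c *\<^sub>C x) * y = c *\<^sub>C (x * y)"
    and mult_scaleC_right: "x * (c *\<^sub>C y) = c *\<^sub>C (x * y)"
    and star_add: "star (x + y) = star x + star y"
    and star_scaleC: "star (c *\<^sub>C x) = cnj c *\<^sub>C star x"
    and star_mult: "star (x * y) = star y * star x"
    and star_star: "star (star x) = x"
    and cstar_identity: "norm (star x * x) = (norm x)\<^sup>2"

definition is_invertible :: "'a::unital_cstar_algebra \<Rightarrow> bool" where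
  "is_invertible a \<longleftrightarrow> (\<exists>b. a * b = 1 \<and> b * a = 1)"

text \<open>The two-sided inverse; meaningful only for invertible elements.\<close>

definition alg_inv :: "'a::unital_cstar_algebra \<Rightarrow> 'a" where
  "alg_inv a = (THE b. a * b = 1 \<and> b * a = 1)"

definition spectrum :: "'a::unital_cstar_algebra \<Rightarrow> complex set" where
  "spectrum a = {t. \<not> is_invertible (t *\<^sub>C 1 - a)}"

definition spectral_seminorm :: "'a::unital_cstar_algebra \<Rightarrow> real" where
  "spectral_seminorm a = Sup {cmod t | t. t \<in> spectrum a}"

definition positive :: "'a::unital_cstar_algebra \<Rightarrow> bool" where
  "positive a \<longleftrightarrow> star a = a \<and> spectrum a \<subseteq> complex_of_real ` {0..}"

definition pos_def_cone :: "'a::unital_cstar_algebra set" where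
  "pos_def_cone = {a. positive a \<and> is_invertible a}"

text \<open>The unique positive square root; meaningful only for positive elements.\<close>

definition pos_sqrt :: "'a::unital_cstar_algebra \<Rightarrow> 'a" where
  "pos_sqrt a = (THE b. positive b \<and> b * b = a)"

definition jordan_product :: "'a::unital_cstar_algebra \<Rightarrow> 'a \<Rightarrow> 'a" where
  "jordan_product a b = (1/2) *\<^sub>C (a * b + b * a)"

definition jordan_star_isomorphism ::
    "('a::unital_cstar_algebra \<Rightarrow> 'b::unital_cstar_algebra) \<Rightarrow> bool" where
  "jordan_star_isomorphism J \<longleftrightarrow>
     bij J \<and>
     (\<forall>a b. J (a + b) = J a + J b) \<and>
     (\<forall>c a. J (c *\<^sub>C a) = c *\<^sub>C J a) \<and>
     (\<forall>a b. J (jordan_product a b) = jordan_product (J a) (J b)) \<and>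
     (\<forall>a. J (star a) = star (J a))"

end

theory Submission
  imports Defs
begin

text \<open>
  For \<open>x\<close>, \<open>y\<close> in the positive definite cone, \<open>t y - x\<close> is congruent to
  \<open>t - y\<^sup>-\<^sup>1\<^sup>/\<^sup>2 x y\<^sup>-\<^sup>1\<^sup>/\<^sup>2\<close>, so the spectral seminorm of \<open>x y\<^sup>-\<^sup>1\<close> is the least \<open>t\<close> with
  \<open>x \<le> t y\<close>. Hence a map satisfying (ii) is a positively homogeneous order isomorphism; after
  composing with the congruence by \<open>\<phi>(e)\<^sup>-\<^sup>1\<^sup>/\<^sup>2\<close> it is a map \<open>f\<close> fixing the unit. A Mazur--Ulam
  argument with the reflections \<open>x \<mapsto> z x\<^sup>-\<^sup>1 z\<close> gives \<open>f(z x\<^sup>-\<^sup>1 z) = f(z) f(x)\<^sup>-\<^sup>1 f(z)\<close>, and therefore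
  \<open>f\<close> preserves squares, triple products \<open>x y x\<close> and commutativity. By congruence, additivity reduces
  to \<open>f(x) + f(y) = 1\<close> when \<open>x + y = 1\<close>. If \<open>z\<close> satisfies \<open>x \<le> \<alpha> z\<close> and \<open>y \<le> (1 - \<alpha>) z\<close>, then
  \<open>w = f\<^sup>-\<^sup>1(f(x) + f(y)) \<le> z\<close>; the elements \<open>z = 1 + \<delta> + N (x - \<alpha>)\<^sup>2\<close> qualify for every \<open>\<alpha>\<close>, and
  since everything commutes this forces \<open>w \<le> 1\<close>. The same for \<open>f\<^sup>-\<^sup>1\<close> gives equality. The additive,
  homogeneous, square-preserving \<open>f\<close> then extends to a Jordan \<open>*\<close>-isomorphism.

  Conversely, \<open>\<sigma>(x y\<^sup>-\<^sup>1)\<close> consists of the \<open>t\<close> for which \<open>t y - x\<close> is not invertible, and Jordan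
  isomorphisms preserve invertibility, \<open>b = a\<^sup>-\<^sup>2\<close> being the solution of \<open>a b a = 1\<close>.
\<close>

section \<open>Involution, inverses and spectrum\<close>

interpretation scaleC: vector_space "scaleC :: complex \<Rightarrow> 'a::unital_cstar_algebra \<Rightarrow> 'a"
proof
  show "1 *\<^sub>C x = x" for x :: 'a
    by (metis of_real_1 scaleC_of_real scaleR_one)
qed (auto simp: scaleC_add_right scaleC_add_left scaleC_scaleC)

lemmas scaleC_simps = mult_scaleC_left mult_scaleC_right scaleC_add_right scaleC_add_left
  scaleC.scale_right_diff_distrib scaleC.scale_left_diff_distrib

lemma scaleC_of_real_one: "complex_of_real r *\<^sub>C (1::'a::unital_cstar_algebra) = of_real r"
  using scaleC_of_real[of r "1::'a"] unfolding of_real_def[where 'a='a] .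

lemma star_zero [simp]: "star (0::'a::unital_cstar_algebra) = 0"
  by (metis add_cancel_left_left star_add)

lemma star_minus [simp]: "star (- x) = - star (x::'a::unital_cstar_algebra)"
  by (metis add.right_inverse minus_unique star_add star_zero)

lemma star_diff: "star (x - y) = star x - star (y::'a::unital_cstar_algebra)"
  using star_add[of x "- y"] by simp

lemma star_one [simp]: "star (1::'a::unital_cstar_algebra) = 1"
  by (metis mult.right_neutral mult.left_neutral star_mult star_star)

lemma star_scaleR: "star (r *\<^sub>R x) = r *\<^sub>R star (x::'a::unital_cstar_algebra)"
  by (metis complex_cnj_complex_of_real scaleC_of_real star_scaleC)

lemma star_of_real [simp]: "star (of_real r :: 'a::unital_cstar_algebra) = of_real r"
  by (simp add: of_real_def star_scaleR)

lemma star_power: "star (x ^ n) = star (x::'a::unital_cstar_algebra) ^ n"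
  by (induction n) (auto simp: star_mult power_commutes)

lemmas star_simps = star_add star_diff star_mult star_scaleR star_power star_star

lemma norm_star [simp]: "norm (star x) = norm (x::'a::unital_cstar_algebra)"
proof -
  have *: "norm x \<le> norm (star x)" for x :: 'a
  proof (cases "x = 0")
    case False
    have "norm x * norm x \<le> norm (star x) * norm x"
      using norm_mult_ineq[of "star x" x] by (simp add: cstar_identity power2_eq_square)
    then show ?thesis using False by simp
  qed simp
  show ?thesis using *[of x] *[of "star x"] by (simp add: star_star)
qed

section \<open>Two-sided inverses\<close>

lemma is_invertibleI:
  assumes "a * b = 1" "c * a = 1"
  shows "is_invertible (a::'a::unital_cstar_algebra)"
proof -
  have "c = b" using assms by (metis mult.assoc mult.left_neutral mult.right_neutral)
  then show ?thesis using assms by (auto simp: is_invertible_def)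
qed

lemma alg_invI:
  assumes "a * b = 1" "b * a = 1"
  shows "alg_inv (a::'a::unital_cstar_algebra) = b"
  unfolding alg_inv_def
proof (rule the_equality)
  fix c assume "a * c = 1 \<and> c * a = 1"
  then show "c = b" using assms by (metis mult.assoc mult.left_neutral mult.right_neutral)
qed (use assms in auto)

lemma alg_inv_right: "is_invertible a \<Longrightarrow> a * alg_inv a = (1::'a::unital_cstar_algebra)"
  and alg_inv_left: "is_invertible a \<Longrightarrow> alg_inv a * a = (1::'a::unital_cstar_algebra)"
  using alg_invI unfolding is_invertible_def by metis+

lemma alg_inv_cancel:
  assumes "is_invertible (a::'a::unital_cstar_algebra)"
  shows "a * (alg_inv a * x) = x" "alg_inv a * (a * x) = x"
  using assms by (simp_all add: mult.assoc[symmetric] alg_inv_right alg_inv_left)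

lemmas alg_inv_simps = alg_inv_right alg_inv_left alg_inv_cancel

lemma is_invertible_1 [simp]: "is_invertible (1::'a::unital_cstar_algebra)"
  by (rule is_invertibleI[of _ 1 1]) auto

lemma is_invertible_alg_inv: "is_invertible a \<Longrightarrow> is_invertible (alg_inv (a::'a::unital_cstar_algebra))"
  by (rule is_invertibleI[of _ a a]) (auto simp: alg_inv_simps)

lemma alg_inv_alg_inv: "is_invertible a \<Longrightarrow> alg_inv (alg_inv (a::'a::unital_cstar_algebra)) = a"
  by (rule alg_invI) (auto simp: alg_inv_simps)

lemma is_invertible_mult:
  assumes "is_invertible a" "is_invertible (b::'a::unital_cstar_algebra)"
  shows "is_invertible (a * b)" "alg_inv (a * b) = alg_inv b * alg_inv a"
proof -
  have *: "a * b * (alg_inv b * alg_inv a) = 1" "(alg_inv b * alg_inv a) * (a * b) = 1"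
    using assms by (simp_all add: mult.assoc alg_inv_simps)
  then show "is_invertible (a * b)" "alg_inv (a * b) = alg_inv b * alg_inv a"
    by (auto intro: is_invertibleI alg_invI)
qed

lemma is_invertible_congruence:
  assumes "is_invertible c" "is_invertible (d::'a::unital_cstar_algebra)"
  shows "is_invertible (c * a * d) \<longleftrightarrow> is_invertible a"
proof
  assume "is_invertible (c * a * d)"
  then have "is_invertible (alg_inv c * (c * a * d) * alg_inv d)"
    using assms by (blast intro: is_invertible_mult(1) is_invertible_alg_inv)
  moreover have "alg_inv c * (c * a * d) * alg_inv d = a"
    using assms by (simp add: mult.assoc alg_inv_simps)
  ultimately show "is_invertible a" by simp
qed (use assms in \<open>simp add: is_invertible_mult\<close>)

text \<open>If \<open>d\<close> inverts \<open>c * c\<close>, then \<open>c * d\<close> is a right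
  and \<open>d * c\<close> a left inverse of \<open>c\<close>. This later recovers invertibility of
  a congruence factor \<open>c\<close> from \<open>\<phi> 1 = c * c\<close>.\<close>

lemma is_invertible_commuting_square:
  assumes "is_invertible (c * c)"
  shows "is_invertible (c::'a::unital_cstar_algebra)"
  using alg_inv_simps(1,2)[OF assms] by (metis is_invertibleI mult.assoc)

lemma is_invertible_scaleC:
  assumes "t \<noteq> 0"
  shows "is_invertible (t *\<^sub>C a) \<longleftrightarrow> is_invertible (a::'a::unital_cstar_algebra)"
proof -
  have "is_invertible (t *\<^sub>C (1::'a))"
    using assms by (intro is_invertibleI[of _ "inverse t *\<^sub>C 1" "inverse t *\<^sub>C 1"])
      (auto simp: scaleC_simps scaleC_scaleC)
  from is_invertible_congruence[OF this is_invertible_1, of a] show ?thesis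
    by (simp add: scaleC_simps)
qed

lemma is_invertible_of_real: "r \<noteq> 0 \<Longrightarrow> is_invertible (of_real r :: 'a::unital_cstar_algebra)"
  using is_invertible_scaleC[of "complex_of_real r" "1::'a"] by (simp add: scaleC_of_real_one)

lemma is_invertible_minus: "is_invertible (- a) \<longleftrightarrow> is_invertible (a::'a::unital_cstar_algebra)"
  using is_invertible_scaleC[of "-1" a] by simp

lemma star_alg_inv:
  assumes "is_invertible (a::'a::unital_cstar_algebra)"
  shows "star (alg_inv a) = alg_inv (star a)"
  using assms by (intro alg_invI[symmetric]) (simp_all add: star_mult[symmetric] alg_inv_simps)

lemma is_invertible_neumann:
  assumes "norm (a::'a::unital_cstar_algebra) < 1"
  shows "is_invertible (1 - a)"
proof -
  have sm: "summable (\<lambda>n. a ^ n)"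
    by (rule summable_comparison_test'[where g = "\<lambda>n. norm a ^ n" and N = 0])
      (use assms in \<open>auto simp: norm_power_ineq intro: summable_geometric\<close>)
  define s where "s = (\<Sum>n. a ^ n)"
  have split: "s = 1 + (\<Sum>n. a ^ Suc n)"
    using suminf_split_head[OF sm] by (simp add: s_def)
  have "(\<Sum>n. a ^ Suc n) = a * s" "(\<Sum>n. a ^ Suc n) = s * a"
    using suminf_mult[OF sm, of a] suminf_mult2[OF sm, of a] by (simp_all add: s_def power_commutes)
  with split have "s = 1 + a * s" "s = 1 + s * a" by simp_all
  then have "(1 - a) * s = 1" "s * (1 - a) = 1"
    by (simp_all add: algebra_simps)
  then show ?thesis by (rule is_invertibleI)
qed

text \<open>Jacobson's identity: with \<open>u\<close> the inverse of \<open>r + a b\<close>, the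
  inverse of \<open>r + b a\<close> is \<open>(1 - b u a) / r\<close>.\<close>

lemma is_invertible_swap:
  assumes "r \<noteq> 0" and inv: "is_invertible (of_real r + a * b :: 'a::unital_cstar_algebra)"
  shows "is_invertible (of_real r + b * a)"
proof -
  define u where "u = alg_inv (of_real r + a * b)"
  have u: "a * (b * u) = 1 - r *\<^sub>R u" "u * (a * b) = 1 - r *\<^sub>R u"
    using alg_inv_right[OF inv] alg_inv_left[OF inv]
    unfolding u_def[symmetric] by (simp_all add: algebra_simps of_real_def)
  have 1: "(of_real r + b * a) * (1 - b * u * a) = of_real r"
  proof -
    have "(of_real r + b * a) * (1 - b * u * a) = of_real r + b * a - r *\<^sub>R (b * u * a) - b * (a * (b * u)) * a"
      by (simp add: algebra_simps of_real_def)
    also have "\<dots> = of_real r" unfolding u by (simp add: algebra_simps)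
    finally show ?thesis .
  qed
  have 2: "(1 - b * u * a) * (of_real r + b * a) = of_real r"
  proof -
    have "(1 - b * u * a) * (of_real r + b * a) = of_real r + b * a - r *\<^sub>R (b * u * a) - b * (u * (a * b)) * a"
      by (simp add: algebra_simps of_real_def)
    also have "\<dots> = of_real r" unfolding u by (simp add: algebra_simps)
    finally show ?thesis .
  qed
  have "of_real (inverse r) * (of_real r :: 'a) = 1" "of_real r * (of_real (inverse r) :: 'a) = 1"
    using \<open>r \<noteq> 0\<close> by (simp_all flip: of_real_mult)
  with 1 2 show ?thesis
    by (metis is_invertibleI mult.assoc)
qed

section \<open>Elementary properties of the spectrum\<close>

lemma spectrum_bound:
  assumes "t \<in> spectrum (a::'a::unital_cstar_algebra)"
  shows "cmod t \<le> norm a"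
proof (rule ccontr)
  assume "\<not> ?thesis"
  then have t: "norm a < cmod t" "t \<noteq> 0" by auto
  then have "norm (inverse t *\<^sub>C a) < 1"
    by (simp add: norm_scaleC norm_inverse inverse_eq_divide norm_divide pos_divide_less_eq)
  then have "is_invertible (1 - inverse t *\<^sub>C a)" by (rule is_invertible_neumann)
  then have "is_invertible (t *\<^sub>C (1 - inverse t *\<^sub>C a))" using t by (simp add: is_invertible_scaleC)
  then show False using assms t by (simp add: spectrum_def scaleC_simps scaleC_scaleC)
qed

text \<open>Factoring \<open>t - x y^-1\<close> as \<open>(t y - x) y^-1\<close> replaces a quotient
  that need not be self-adjoint by a pencil linear in \<open>x\<close> and \<open>y\<close>, on
  which a Jordan isomorphism can act.\<close>

lemma spectrum_mult_alg_inv: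
  assumes "is_invertible (y::'a::unital_cstar_algebra)"
  shows "spectrum (x * alg_inv y) = {t. \<not> is_invertible (t *\<^sub>C y - x)}"
proof -
  have "t *\<^sub>C 1 - x * alg_inv y = 1 * (t *\<^sub>C y - x) * alg_inv y" for t
    using assms by (simp add: algebra_simps scaleC_simps alg_inv_simps)
  then show ?thesis unfolding spectrum_def
    using is_invertible_congruence[OF is_invertible_1 is_invertible_alg_inv[OF assms]] by simp
qed

lemma spectrum_similar:
  assumes "is_invertible (c::'a::unital_cstar_algebra)"
  shows "spectrum (c * a * alg_inv c) = spectrum a"
proof -
  have "t *\<^sub>C 1 - c * a * alg_inv c = c * (t *\<^sub>C 1 - a) * alg_inv c" for t
    using assms by (simp add: algebra_simps scaleC_simps alg_inv_simps)
  then show ?thesis unfolding spectrum_def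
    using is_invertible_congruence[OF assms is_invertible_alg_inv[OF assms]] by simp
qed

lemma spectrum_shift: "t \<in> spectrum (a + s *\<^sub>C 1) \<longleftrightarrow> t - s \<in> spectrum (a::'a::unital_cstar_algebra)"
  by (simp add: spectrum_def scaleC_simps algebra_simps)

lemma spectrum_scaleC:
  assumes "s \<noteq> 0" "t \<in> spectrum (a::'a::unital_cstar_algebra)"
  shows "s * t \<in> spectrum (s *\<^sub>C a)"
proof -
  have "(s * t) *\<^sub>C 1 - s *\<^sub>C a = s *\<^sub>C (t *\<^sub>C 1 - a)" by (simp add: scaleC_simps scaleC_scaleC)
  then show ?thesis using assms by (simp add: spectrum_def is_invertible_scaleC)
qed

section \<open>The spectral radius of normal elements\<close>

text \<open>The resolvent identity bounds \<open>R l - R m\<close> by a multiple of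
  \<open>cmod (l - m) * norm (R l)\<close>, so what remains is to keep \<open>R l\<close> bounded
  near \<open>m\<close>.\<close>

lemma continuous_resolvent:
  fixes a :: "'a::unital_cstar_algebra"
  assumes inv: "\<And>l. cmod l \<le> 1 \<Longrightarrow> is_invertible (1 - l *\<^sub>C a)"
  shows "continuous_on (cball 0 1) (\<lambda>l. alg_inv (1 - l *\<^sub>C a))"
  unfolding continuous_on_iff
proof (intro ballI allI impI)
  define R where "R l = alg_inv (1 - l *\<^sub>C a)" for l
  fix m :: complex and e :: real
  assume m: "m \<in> cball 0 1" and e: "0 < e"
  have resolvent: "R l - R m = (l - m) *\<^sub>C (R l * a * R m)" if "cmod l \<le> 1" for l
  proof -
    have "R l - R m = R l * ((1 - m *\<^sub>C a) - (1 - l *\<^sub>C a)) * R m"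
    proof -
      have "R l - R m = R l * ((1 - m *\<^sub>C a) * R m) - (R l * (1 - l *\<^sub>C a)) * R m"
        using inv[of m] inv[OF that] m by (simp add: R_def alg_inv_simps)
      then show ?thesis by (simp only: right_diff_distrib left_diff_distrib mult.assoc)
    qed
    also have "\<dots> = (l - m) *\<^sub>C (R l * a * R m)"
      by (simp add: scaleC_simps algebra_simps)
    finally show ?thesis .
  qed
  define K where "K = norm a * norm (R m)"
  have K: "K \<ge> 0" by (simp add: K_def)
  \<comment> \<open>The first bound makes \<open>cmod (l - m) * K\<close> at most 1/2, whence
    \<open>norm (R l)\<close> is at most \<open>2 * norm (R m)\<close>; the second then pushes the
    difference below \<open>e\<close>. The summands 1 keep the denominators positive.\<close>
  define d where "d = min (1 / (2 * K + 1)) (e / (2 * norm (R m) * K + 1))"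
  have pos: "2 * norm (R m) * K + 1 > 0" using K by (intro add_nonneg_pos) auto
  have "d > 0" using e K pos by (simp add: d_def)
  moreover have "dist (R l) (R m) < e" if l: "l \<in> cball 0 1" "dist l m < d" for l
  proof -
    have lm: "cmod (l - m) < 1 / (2 * K + 1)" "cmod (l - m) < e / (2 * norm (R m) * K + 1)"
      using l(2) by (auto simp: d_def dist_norm)
    have n: "norm (R l - R m) \<le> cmod (l - m) * (norm (R l) * K)"
    proof -
      have "norm (R l * a * R m) \<le> norm (R l) * norm a * norm (R m)"
        by (meson norm_mult_ineq mult_right_mono norm_ge_zero order_trans)
      then show ?thesis using resolvent[of l] l(1)
        by (simp add: norm_scaleC K_def mult_left_mono mult.assoc)
    qed
    have "cmod (l - m) * K \<le> 1 / 2"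
    proof -
      have "cmod (l - m) * K \<le> 1 / (2 * K + 1) * K"
        using lm(1) K by (intro mult_right_mono) auto
      also have "\<dots> \<le> 1 / 2" using K by (simp add: divide_simps)
      finally show ?thesis .
    qed
    then have "norm (R l - R m) \<le> norm (R l) * (1 / 2)"
      using n mult_left_mono[of "cmod (l - m) * K" "1/2" "norm (R l)"] by (simp add: mult_ac)
    then have b: "norm (R l) \<le> 2 * norm (R m)"
      using norm_triangle_ineq2[of "R l" "R m"] by linarith
    have "norm (R l - R m) \<le> cmod (l - m) * (2 * norm (R m) * K)"
      using n mult_right_mono[OF b K] by (meson mult_left_mono norm_ge_zero order_trans)
    also have "\<dots> \<le> cmod (l - m) * (2 * norm (R m) * K + 1)"
      by (intro mult_left_mono) auto
    also have "\<dots> < e" using lm(2) pos by (simp add: pos_less_divide_eq)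
    finally show ?thesis by (simp add: dist_norm)
  qed
  ultimately show "\<exists>d>0. \<forall>x'\<in>cball 0 1. dist x' m < d \<longrightarrow>
      dist (alg_inv (1 - x' *\<^sub>C a)) (alg_inv (1 - m *\<^sub>C a)) < e"
    by (auto simp: R_def)
qed

text \<open>Partial fractions: \<open>1 / (1 - l^2 b^2)\<close> is the mean of
  \<open>1 / (1 - l b)\<close> and \<open>1 / (1 + l b)\<close>. This is one halving step of the
  average over roots of unity.\<close>

lemma resolvent_squaring:
  fixes b :: "'a::unital_cstar_algebra"
  assumes inv: "is_invertible (1 - l *\<^sub>C b)" "is_invertible (1 - (- l) *\<^sub>C b)"
  shows "is_invertible (1 - l\<^sup>2 *\<^sub>C b\<^sup>2)"
    and "alg_inv (1 - l\<^sup>2 *\<^sub>C b\<^sup>2) = (1/2) *\<^sub>R (alg_inv (1 - l *\<^sub>C b) + alg_inv (1 - (- l) *\<^sub>C b))"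
proof -
  define u v where "u = 1 - l *\<^sub>C b" and "v = 1 - (- l) *\<^sub>C b"
  have uv: "u * v = 1 - l\<^sup>2 *\<^sub>C b\<^sup>2" "v * u = 1 - l\<^sup>2 *\<^sub>C b\<^sup>2" "u + v = 2"
    by (simp_all add: u_def v_def algebra_simps scaleC_simps scaleC_scaleC power2_eq_square)
  have half: "(1/2) *\<^sub>R (2::'a) = 1" using scaleR_2[of "1::'a"] by (metis divide_self_if one_add_one scaleR_collapse scaleR_half_double)
  have i: "is_invertible u" "is_invertible v" using inv by (simp_all add: u_def v_def)
  show inv2: "is_invertible (1 - l\<^sup>2 *\<^sub>C b\<^sup>2)" using is_invertible_mult(1)[OF i] uv by simp
  have "u * v * (alg_inv u + alg_inv v) = u * v * alg_inv u + u * v * alg_inv v"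
    by (simp add: distrib_left)
  also have "\<dots> = v * u * alg_inv u + u * v * alg_inv v" using uv by simp
  also have "\<dots> = 2" using uv(3) i by (simp add: mult.assoc alg_inv_simps add.commute)
  finally have 1: "u * v * ((1/2) *\<^sub>R (alg_inv u + alg_inv v)) = 1"
    unfolding mult_scaleR_right using half by simp
  have "(alg_inv u + alg_inv v) * (u * v) = alg_inv u * (u * v) + alg_inv v * (u * v)"
    by (simp add: distrib_right)
  also have "\<dots> = alg_inv u * (u * v) + alg_inv v * (v * u)" using uv by simp
  also have "\<dots> = 2" using uv(3) i by (simp add: alg_inv_simps add.commute)
  finally have 2: "((1/2) *\<^sub>R (alg_inv u + alg_inv v)) * (u * v) = 1"
    unfolding mult_scaleR_left using half by simp
  show "alg_inv (1 - l\<^sup>2 *\<^sub>C b\<^sup>2) = (1/2) *\<^sub>R (alg_inv (1 - l *\<^sub>C b) + alg_inv (1 - (- l) *\<^sub>C b))"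
    using alg_invI[OF 1 2] uv by (simp add: u_def v_def)
qed

text \<open>
  Rickart's elementary proof that the spectral radius is attained: averaging the resolvent over
  roots of unity (here of order \<open>2\<^sup>m\<close>, by repeated halving) yields the resolvent of a power, and
  uniform continuity of the resolvent on the closed disc then forces the powers to be small.
\<close>

lemma spectrum_attains_norm_aux:
  fixes a :: "'a::unital_cstar_algebra"
  assumes pow: "\<And>n. norm (a ^ (2 ^ n)) = 1"
  shows "\<exists>t\<in>spectrum a. cmod t = 1"
proof (rule ccontr)
  assume neg: "\<not> ?thesis"
  have na: "norm a = 1" using pow[of 0] by simp
  have inv: "is_invertible (1 - l *\<^sub>C a)" if "cmod l \<le> 1" for l
  proof (cases "cmod l = 1")
    case True
    then have l: "l \<noteq> 0" "cmod (inverse l) = 1" by (auto simp: norm_inverse)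
    then have "is_invertible (inverse l *\<^sub>C 1 - a)" using neg by (auto simp: spectrum_def)
    then have "is_invertible (l *\<^sub>C (inverse l *\<^sub>C 1 - a))" using l by (simp add: is_invertible_scaleC)
    then show ?thesis using l by (simp add: scaleC_simps scaleC_scaleC)
  next
    case False
    then show ?thesis using that na by (intro is_invertible_neumann) (simp add: norm_scaleC)
  qed
  define Q where "Q m l = alg_inv (1 - l *\<^sub>C (a ^ (2 ^ m)))" for m l
  have "uniformly_continuous_on (cball 0 1) (\<lambda>l. alg_inv (1 - l *\<^sub>C a))"
    using continuous_resolvent[OF inv] by (rule compact_uniformly_continuous) auto
  then obtain d where d: "d > 0"
    "\<And>l m. cmod l \<le> 1 \<Longrightarrow> cmod m \<le> 1 \<Longrightarrow> dist m l < d \<Longrightarrow> dist (Q 0 m) (Q 0 l) < 1/8"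
    unfolding uniformly_continuous_on_def Q_def
    by (auto simp: dest!: spec[of _ "1/8"])
  \<comment> \<open>For \<open>l\<close> in the closed disc, \<open>l\<close> and
    \<open>s * l\<close> are less than \<open>d\<close> apart; the maximum with 1/2 keeps
    \<open>s\<close> positive.\<close>
  define s where "s = max (1/2) (1 - d/2)"
  have s: "0 < s" "s < 1" "1 - s < d" using d(1) by (auto simp: s_def)
  \<comment> \<open>The bound 1/8 survives squaring because it passes to the mean of two
    differences, while the shrinking factor becomes \<open>s ^ (2 ^ m)\<close>, which tends to
    0.\<close>
  have key: "(\<forall>l. cmod l \<le> 1 \<longrightarrow> is_invertible (1 - l *\<^sub>C (a ^ (2 ^ m)))) \<and>
     (\<forall>l. cmod l \<le> 1 \<longrightarrow> norm (Q m l - Q m (of_real (s ^ (2 ^ m)) * l)) \<le> 1/8)" for m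
  proof (induction m)
    case 0
    have "norm (Q 0 l - Q 0 (of_real s * l)) \<le> 1/8" if l: "cmod l \<le> 1" for l
    proof -
      have "l - of_real s * l = of_real (1 - s) * l" by (simp add: algebra_simps)
      then have "dist l (of_real s * l) = (1 - s) * cmod l"
        using s by (simp add: dist_norm norm_mult del: of_real_diff)
      also have "\<dots> \<le> (1 - s) * 1" using s l by (intro mult_left_mono) auto
      finally have "dist l (of_real s * l) < d" using s by simp
      moreover have "cmod (of_real s * l) \<le> 1" using s l by (simp add: norm_mult mult_le_one)
      ultimately show ?thesis using d(2)[OF _ l, of "of_real s * l"] d(2)[of "of_real s * l" l] l
        by (force simp: dist_norm)
    qed
    then show ?case using inv by simp
  next
    case (Suc m)
    have sm: "0 \<le> s ^ (2 ^ m)" "s ^ (2 ^ m) \<le> 1" using s by (auto simp: power_le_one)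
    have sq: "a ^ (2 ^ Suc m) = (a ^ (2 ^ m))\<^sup>2" by (simp add: power_mult[symmetric] mult.commute)
    have I: "is_invertible (1 - l *\<^sub>C (a ^ (2 ^ m)))" if "cmod l \<le> 1" for l
      using Suc that by auto
    have J: "is_invertible (1 - (l\<^sup>2) *\<^sub>C (a ^ (2 ^ Suc m)))"
        "Q (Suc m) (l\<^sup>2) = (1/2) *\<^sub>R (Q m l + Q m (- l))" if "cmod l \<le> 1" for l
      using resolvent_squaring[OF I[OF that] I[of "- l"]] that unfolding sq Q_def by simp_all
    show ?case
    proof (intro conjI allI impI)
      fix l :: complex assume l: "cmod l \<le> 1"
      define k where "k = csqrt l"
      have k: "l = k\<^sup>2" "cmod k \<le> 1" using l by (simp_all add: k_def)
      show "is_invertible (1 - l *\<^sub>C (a ^ (2 ^ Suc m)))" using J(1)[OF k(2)] k(1) by simp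
      define r where "r = complex_of_real (s ^ (2 ^ m))"
      have rk: "cmod (r * k) \<le> 1"
        using sm k(2) by (simp add: r_def norm_mult mult_le_one del: of_real_power)
      have r2: "of_real (s ^ (2 ^ Suc m)) * l = (r * k)\<^sup>2"
        by (simp add: r_def k(1) power_mult_distrib power_mult[symmetric] mult.commute)
      have "Q (Suc m) l - Q (Suc m) (of_real (s ^ (2 ^ Suc m)) * l)
          = (1/2) *\<^sub>R ((Q m k - Q m (r * k)) + (Q m (- k) - Q m (r * (- k))))"
        unfolding r2 unfolding k(1) J(2)[OF k(2)] J(2)[OF rk] by (simp add: algebra_simps)
      also have "norm \<dots> \<le> 1/2 * (norm (Q m k - Q m (r * k)) + norm (Q m (- k) - Q m (r * (- k))))"
        using norm_triangle_ineq[of "Q m k - Q m (r * k)" "Q m (- k) - Q m (r * (- k))"] by simp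
      also have "\<dots> \<le> 1/8"
      proof -
        have "norm (Q m k - Q m (r * k)) \<le> 1/8" "norm (Q m (- k) - Q m (r * (- k))) \<le> 1/8"
          using conjunct2[OF Suc, rule_format, of k] conjunct2[OF Suc, rule_format, of "- k"] k(2)
          unfolding r_def by simp_all
        then show ?thesis by simp
      qed
      finally show "norm (Q (Suc m) l - Q (Suc m) (of_real (s ^ (2 ^ Suc m)) * l)) \<le> 1/8" .
    qed
  qed
  obtain m where m: "s ^ m < 1/9" using real_arch_pow_inv[of "1/9" s] s by auto
  define r where "r = s ^ (2 ^ m)"
  have r: "0 \<le> r" "r < 1/9"
  proof -
    have "s ^ (2 ^ m) \<le> s ^ m" using s by (intro power_decreasing) (auto simp: less_imp_le)
    then show "r < 1/9" using m by (simp add: r_def)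
    show "0 \<le> r" using s by (simp add: r_def)
  qed
  define b where "b = a ^ (2 ^ m)"
  have nb: "norm b = 1" using pow by (simp add: b_def)
  \<comment> \<open>At the tiny radius \<open>r\<close> the resolvent \<open>q\<close> of
    \<open>b\<close> is close to 1. By \<open>key\<close> it is close to \<open>Q m 1\<close>, the
    inverse of \<open>1 - b\<close>, which is therefore within 1/4 of 1; this gives
    \<open>norm b \<le> 1/2\<close>, against \<open>norm b = 1\<close>.\<close>
  define q where "q = Q m (of_real r)"
  have "is_invertible (1 - of_real r *\<^sub>C b)" using key[of m] r by (auto simp: b_def)
  then have "q = 1 + q * (of_real r *\<^sub>C b)"
    using alg_inv_left[of "1 - of_real r *\<^sub>C b"] unfolding q_def Q_def b_def
    by (simp add: algebra_simps)
  then have q1: "q - 1 = r *\<^sub>R (q * b)"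
    by (metis add_diff_cancel_left' mult_scaleC_right scaleC_of_real)
  have "norm (q - 1) \<le> r * norm q"
    unfolding q1 using r nb norm_mult_ineq[of q b] by (simp add: mult_left_mono)
  also have "\<dots> \<le> 1/9 * (1 + norm (q - 1))"
    using r norm_triangle_ineq[of 1 "q - 1"] by (intro mult_mono) auto
  finally have "norm (q - 1) \<le> 1/8" by simp
  moreover have "norm (Q m 1 - q) \<le> 1/8"
  proof -
    have "norm (Q m 1 - Q m (of_real (s ^ 2 ^ m) * 1)) \<le> 1/8" using key[of m] by (metis norm_one order_refl)
    then show ?thesis by (simp add: q_def r_def)
  qed
  ultimately have Q1: "norm (Q m 1 - 1) \<le> 1/4"
    using norm_triangle_ineq[of "Q m 1 - q" "q - 1"] by simp
  have "is_invertible (1 - b)" using key[of m] by (metis b_def norm_one order_refl scaleC.scale_one)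
  then have "Q m 1 * (1 - b) = 1" by (simp add: Q_def b_def[symmetric] alg_inv_left)
  then have "b = (Q m 1 - 1) * (1 - b)" by (simp add: algebra_simps)
  then have "norm b \<le> norm (Q m 1 - 1) * norm (1 - b)" by (metis norm_mult_ineq)
  also have "\<dots> \<le> 1/4 * 2"
    using Q1 norm_triangle_ineq4[of 1 b] nb by (intro mult_mono) auto
  finally show False using nb by simp
qed

text \<open>Normality identifies \<open>star (a * a) * (a * a)\<close> with
  \<open>star (star a * a) * (star a * a)\<close>, so the norm identity of the algebra applies
  twice.\<close>

lemma norm_normal_square:
  assumes "a * star a = star a * (a::'a::unital_cstar_algebra)"
  shows "norm (a * a) = (norm a)\<^sup>2"
proof -
  have "(norm (a * a))\<^sup>2 = norm (star (a * a) * (a * a))" by (rule cstar_identity[symmetric])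
  also have "star (a * a) * (a * a) = star a * (star a * a) * a" by (simp add: star_mult mult.assoc)
  also have "\<dots> = star a * (a * star a) * a" using assms by simp
  also have "\<dots> = star (star a * a) * (star a * a)" by (simp add: star_mult star_star mult.assoc)
  also have "norm \<dots> = ((norm a)\<^sup>2)\<^sup>2" by (simp only: cstar_identity)
  finally show ?thesis by (metis norm_ge_zero power2_eq_iff_nonneg zero_le_power2)
qed

lemma norm_normal_power:
  assumes "a * star a = star a * (a::'a::unital_cstar_algebra)"
  shows "norm (a ^ (2 ^ n)) = norm a ^ (2 ^ n)"
proof (induction n)
  case (Suc n)
  have c: "a ^ k * star a ^ j = star a ^ j * a ^ k" for k j
    using assms by (metis power_commuting_commutes)
  have "a ^ (2 ^ Suc n) = a ^ (2 ^ n) * a ^ (2 ^ n)" by (simp add: power_add[symmetric] mult_2)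
  then show ?case using Suc norm_normal_square[of "a ^ (2 ^ n)"] c
    by (simp add: star_power power_mult[symmetric] mult.commute)
qed simp

text \<open>After scaling to norm 1, normality keeps all \<open>2 ^ n\<close>-th powers at norm 1,
  which is what the averaging argument asks for.\<close>

lemma spectrum_attains_norm:
  assumes nor: "a * star a = star a * (a::'a::unital_cstar_algebra)"
  obtains t where "t \<in> spectrum a" "cmod t = norm a"
proof (cases "a = 0")
  case True
  have "\<not> is_invertible (0::'a)" by (simp add: is_invertible_def)
  then have "0 \<in> spectrum a" using True by (simp add: spectrum_def)
  then show thesis using that[of 0] True by simp
next
  case False
  define b where "b = complex_of_real (inverse (norm a)) *\<^sub>C a"
  have "b * star b = star b * b" using nor by (simp add: b_def star_scaleC scaleC_simps)
  moreover have nb: "norm b = 1" using False by (simp add: b_def norm_scaleC del: of_real_inverse)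
  ultimately have "norm (b ^ (2 ^ n)) = 1" for n by (simp add: norm_normal_power)
  then obtain t where t: "t \<in> spectrum b" "cmod t = 1" using spectrum_attains_norm_aux by blast
  have "complex_of_real (norm a) * t \<in> spectrum (complex_of_real (norm a) *\<^sub>C b)"
    using False t by (intro spectrum_scaleC) auto
  also have "complex_of_real (norm a) *\<^sub>C b = a"
    using False by (simp add: b_def scaleC_scaleC flip: of_real_mult)
  finally show thesis using t that by (simp add: norm_mult)
qed

section \<open>Positive elements\<close>

text \<open>Arens' shift: \<open>t + i s\<close> lies in the spectrum of \<open>a + i s\<close>,
  whose squared norm is at most \<open>(norm a)^2 + s^2\<close>. The terms \<open>s^2\<close>
  cancel, and \<open>s\<close> is chosen so that the cross term \<open>2 * Im t * s\<close> exceeds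
  \<open>(norm a)^2\<close> by 1.\<close>

lemma spectrum_selfadjoint:
  assumes sa: "star a = (a::'a::unital_cstar_algebra)" and t: "t \<in> spectrum a"
  shows "t \<in> \<real>"
proof (rule ccontr)
  assume "t \<notin> \<real>"
  then have b: "Im t \<noteq> 0" by (simp add: complex_is_Real_iff)
  define s where "s = ((norm a)\<^sup>2 + 1) / (2 * Im t)"
  define c where "c = a + (\<i> * of_real s) *\<^sub>C 1"
  have "t + \<i> * of_real s \<in> spectrum c" using t by (simp add: c_def spectrum_shift)
  then have "(cmod (t + \<i> * of_real s))\<^sup>2 \<le> (norm c)\<^sup>2"
    using spectrum_bound by (intro power_mono) auto
  also have "\<dots> = norm (star c * c)" by (simp add: cstar_identity)
  also have "star c * c = a * a + of_real (s\<^sup>2)"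
    by (simp add: c_def star_add star_scaleC sa algebra_simps scaleC_simps scaleC_scaleC
        power2_eq_square flip: scaleC_of_real_one)
  also have "norm \<dots> \<le> (norm a)\<^sup>2 + s\<^sup>2"
    using norm_triangle_ineq[of "a * a" "of_real (s\<^sup>2)"] norm_mult_ineq[of a a]
    by (simp add: power2_eq_square del: of_real_mult of_real_power)
  finally have "(Re t)\<^sup>2 + (Im t)\<^sup>2 + 2 * Im t * s \<le> (norm a)\<^sup>2"
    by (simp add: cmod_power2 power2_sum algebra_simps)
  moreover have "2 * Im t * s = (norm a)\<^sup>2 + 1" using b by (simp add: s_def)
  ultimately show False using zero_le_power2[of "Re t"] zero_le_power2[of "Im t"] by linarith
qed

lemma selfadjoint_attains_norm:
  assumes "star a = (a::'a::unital_cstar_algebra)"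
  obtains r where "complex_of_real r \<in> spectrum a" "\<bar>r\<bar> = norm a"
proof -
  from assms have "a * star a = star a * a" by simp
  then obtain t where t: "t \<in> spectrum a" "cmod t = norm a" by (rule spectrum_attains_norm)
  then obtain r where "t = of_real r" using spectrum_selfadjoint[OF assms] by (auto elim: Reals_cases)
  then show thesis using t that by simp
qed

text \<open>A shift argument for the imaginary part \<open>K\<close> of \<open>a\<close>: since
  \<open>K - s\<close> is the imaginary part of the normal element \<open>n = a - i s\<close>, a
  norm-attaining \<open>m\<close> in the spectrum of \<open>K\<close> satisfies
  \<open>\<bar>m - s\<bar> \<le> norm n\<close>. The real spectrum of \<open>a\<close> bounds
  \<open>(norm n)^2\<close> by \<open>(norm a)^2 + s^2\<close>, and letting \<open>s\<close> vary
  forces \<open>m = 0\<close>.\<close>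

lemma normal_real_spectrum_selfadjoint:
  assumes nor: "a * star a = star a * (a::'a::unital_cstar_algebra)"
    and real: "spectrum a \<subseteq> \<real>"
  shows "star a = a"
proof -
  define K where "K = (- \<i> / 2) *\<^sub>C (a - star a)"
  have saK: "star K = K"
    by (simp add: K_def star_scaleC star_diff star_star scaleC_simps)
  obtain m where m: "complex_of_real m \<in> spectrum K" "\<bar>m\<bar> = norm K"
    using selfadjoint_attains_norm[OF saK] .
  have bound: "(m - s)\<^sup>2 \<le> (norm a)\<^sup>2 + s\<^sup>2" for s
  proof -
    define z where "z = - \<i> * complex_of_real s"
    define n where "n = a + z *\<^sub>C 1"
    have cz: "cnj z = - z" by (simp add: z_def)
    have sn: "star n = star a + cnj z *\<^sub>C 1" by (simp add: n_def star_add star_scaleC)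
    have "n * star n = star n * n" unfolding sn
      by (simp add: n_def distrib_left distrib_right mult_scaleC_left mult_scaleC_right nor
          scaleC_scaleC scaleC_add_right ac_simps)
    then obtain u where u: "u \<in> spectrum n" "cmod u = norm n" by (rule spectrum_attains_norm)
    have "u + \<i> * of_real s \<in> spectrum a" using u(1) by (simp add: n_def z_def spectrum_shift del: scaleC.scale_minus_left)
    then obtain t where t: "u = of_real t - \<i> * of_real s" "complex_of_real t \<in> spectrum a"
      using real by (metis Reals_cases eq_diff_eq subsetD)
    have "\<bar>t\<bar> \<le> norm a" using spectrum_bound[OF t(2)] by simp
    then have "t\<^sup>2 \<le> (norm a)\<^sup>2" by (metis abs_ge_zero power2_abs power_mono)
    then have nn: "(norm n)\<^sup>2 \<le> (norm a)\<^sup>2 + s\<^sup>2"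
      unfolding u(2)[symmetric] t(1) by (simp add: cmod_power2)
    have shift: "K + (- of_real s) *\<^sub>C 1 = (- \<i> / 2) *\<^sub>C (n - star n)"
    proof -
      have "n - star n = (a - star a) + (2 * z) *\<^sub>C 1"
        unfolding sn cz by (simp add: n_def scaleC_add_left[symmetric])
      then show ?thesis by (simp add: K_def z_def scaleC_simps scaleC_scaleC)
    qed
    have "of_real m - of_real s \<in> spectrum (K + (- of_real s) *\<^sub>C 1)"
      using m(1) unfolding spectrum_shift by simp
    then have "cmod (of_real m - of_real s) \<le> norm ((- \<i> / 2) *\<^sub>C (n - star n))"
      using spectrum_bound shift by metis
    also have "\<dots> \<le> norm n"
      using norm_triangle_ineq4[of n "star n"] by (simp add: norm_scaleC norm_divide)
    finally have "\<bar>m - s\<bar> \<le> norm n" by (metis norm_of_real of_real_diff)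
    then have "(m - s)\<^sup>2 \<le> (norm n)\<^sup>2" by (metis abs_ge_zero power2_abs power_mono)
    then show ?thesis using nn by linarith
  qed
  have "m = 0"
  proof (rule ccontr)
    assume "m \<noteq> 0"
    define s where "s = - ((norm a)\<^sup>2 + 1) / (2 * m)"
    have "m\<^sup>2 - 2 * m * s \<le> (norm a)\<^sup>2" using bound[of s] by (simp add: power2_diff)
    moreover have "- 2 * m * s = (norm a)\<^sup>2 + 1" using \<open>m \<noteq> 0\<close> by (simp add: s_def)
    ultimately show False using zero_le_power2[of m] by linarith
  qed
  then have "K = 0" using m by simp
  then show ?thesis by (simp add: K_def)
qed

section \<open>Order structure given by the positive elements\<close>

lemma positive_selfadjoint: "positive a \<Longrightarrow> star a = a"
  by (simp add: positive_def)

text \<open>The negative spectral values are the \<open>- r\<close> for which \<open>r + a\<close>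
  is singular. In this form positivity can be checked by algebraic factorizations.\<close>

lemma positive_iff:
  assumes sa: "star a = (a::'a::unital_cstar_algebra)"
  shows "positive a \<longleftrightarrow> (\<forall>r>0. is_invertible (of_real r + a))"
proof -
  have *: "complex_of_real (- r) \<in> spectrum a \<longleftrightarrow> \<not> is_invertible (of_real r + a)" for r
  proof -
    have "complex_of_real (- r) *\<^sub>C 1 - a = - (of_real r + a)"
      unfolding scaleC_of_real_one by simp
    then show ?thesis by (simp only: spectrum_def mem_Collect_eq is_invertible_minus)
  qed
  show ?thesis
  proof
    assume pos: "positive a"
    show "\<forall>r>0. is_invertible (of_real r + a)"
    proof (intro allI impI)
      fix r :: real assume "r > 0"
      then have "complex_of_real (- r) \<notin> complex_of_real ` {0..}"
        by (simp add: image_iff complex_eq_iff)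
      then show "is_invertible (of_real r + a)" using pos * unfolding positive_def by blast
    qed
  next
    assume inv: "\<forall>r>0. is_invertible (of_real r + a)"
    have "spectrum a \<subseteq> complex_of_real ` {0..}"
    proof
      fix t assume t: "t \<in> spectrum a"
      then obtain r where r: "t = of_real r"
        using spectrum_selfadjoint[OF sa] by (auto elim: Reals_cases)
      have "\<not> r < 0"
      proof
        assume "r < 0"
        then have "is_invertible (of_real (- r) + a)" using inv by (simp only: neg_0_less_iff_less)
        then show False using *[of "- r"] t r by simp
      qed
      then show "t \<in> complex_of_real ` {0..}" using r by auto
    qed
    then show "positive a" using sa by (simp add: positive_def)
  qed
qed

lemma positive_spectrum:
  assumes "positive a" "complex_of_real r \<in> spectrum (a::'a::unital_cstar_algebra)"
  shows "0 \<le> r"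
  using assms unfolding positive_def by auto

lemma spectrum_of_real_minus:
  "complex_of_real t \<in> spectrum (of_real r - a) \<longleftrightarrow>
   complex_of_real (r - t) \<in> spectrum (a::'a::unital_cstar_algebra)"
proof -
  have "complex_of_real t *\<^sub>C 1 - (of_real r - a) = - (complex_of_real (r - t) *\<^sub>C 1 - a)"
    unfolding scaleC_of_real_one by simp
  then show ?thesis by (simp only: spectrum_def mem_Collect_eq is_invertible_minus)
qed

text \<open>The spectrum of \<open>r - a\<close> again lies in the interval from 0 to
  \<open>r\<close>. Together with \<open>positiveI_norm\<close> this expresses positivity by a norm
  inequality, which opens sums to the triangle inequality.\<close>

lemma positive_norm_bound:
  assumes pos: "positive (a::'a::unital_cstar_algebra)" and r: "norm a \<le> r"
  shows "norm (of_real r - a) \<le> r"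
proof -
  have "star (of_real r - a) = of_real r - a"
    using positive_selfadjoint[OF pos] by (simp add: star_diff)
  then obtain t where t: "complex_of_real t \<in> spectrum (of_real r - a)" "\<bar>t\<bar> = norm (of_real r - a)"
    by (rule selfadjoint_attains_norm)
  then have s: "complex_of_real (r - t) \<in> spectrum a" by (simp only: spectrum_of_real_minus)
  have "0 \<le> r - t" using positive_spectrum[OF pos s] .
  moreover have "\<bar>r - t\<bar> \<le> r" using spectrum_bound[OF s] r by (simp del: of_real_diff)
  ultimately show ?thesis using t(2) by linarith
qed

lemma positiveI_norm:
  assumes sa: "star a = (a::'a::unital_cstar_algebra)" and n: "norm (of_real r - a) \<le> r"
  shows "positive a"
  unfolding positive_def
proof (intro conjI sa subsetI)
  fix t assume t: "t \<in> spectrum a"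
  then obtain s where s: "t = of_real s"
    using spectrum_selfadjoint[OF sa] by (auto elim: Reals_cases)
  then have "complex_of_real (r - s) \<in> spectrum (of_real r - a)"
    using t unfolding spectrum_of_real_minus by simp
  from spectrum_bound[OF this] have "\<bar>r - s\<bar> \<le> r" using n by (simp del: of_real_diff)
  then show "t \<in> complex_of_real ` {0..}" using s by auto
qed

lemma positive_add:
  assumes "positive a" "positive (b::'a::unital_cstar_algebra)"
  shows "positive (a + b)"
proof (rule positiveI_norm)
  show "star (a + b) = a + b" using assms by (simp add: star_add positive_selfadjoint)
  have "of_real (norm a + norm b) - (a + b) = (of_real (norm a) - a) + (of_real (norm b) - b)"
    by simp
  then show "norm (of_real (norm a + norm b) - (a + b)) \<le> norm a + norm b"
    using norm_triangle_mono[OF positive_norm_bound[OF assms(1) order_refl]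
        positive_norm_bound[OF assms(2) order_refl]] by (simp only:)
qed

lemma positive_of_real: "0 \<le> r \<Longrightarrow> positive (of_real r :: 'a::unital_cstar_algebra)"
  by (rule positiveI_norm[where r = r]) auto

lemma positive_scaleR:
  assumes "0 \<le> r" "positive (a::'a::unital_cstar_algebra)"
  shows "positive (r *\<^sub>R a)"
proof (rule positiveI_norm)
  show "star (r *\<^sub>R a) = r *\<^sub>R a" using assms by (simp add: star_scaleR positive_selfadjoint)
  have "of_real (r * norm a) - r *\<^sub>R a = r *\<^sub>R (of_real (norm a) - a)"
    by (simp add: scaleR_right_diff_distrib of_real_def)
  then show "norm (of_real (r * norm a) - r *\<^sub>R a) \<le> r * norm a"
    using assms positive_norm_bound[OF assms(2) order_refl] by (simp add: mult_left_mono)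
qed

lemma positive_scaleR_iff:
  assumes "0 < r"
  shows "positive (r *\<^sub>R a) \<longleftrightarrow> positive (a::'a::unital_cstar_algebra)"
  using positive_scaleR[of "inverse r" "r *\<^sub>R a"] positive_scaleR[of r a] assms by auto

lemma positive_closed:
  assumes "\<And>e. 0 < e \<Longrightarrow> positive (of_real e + a)"
  shows "positive (a::'a::unital_cstar_algebra)"
proof -
  have sa: "star a = a" using positive_selfadjoint[OF assms[of 1]] by (simp add: star_add)
  have "is_invertible (of_real r + a)" if "r > 0" for r
  proof -
    have "of_real r = of_real (r/2) + (of_real (r/2) :: 'a)" by (simp flip: of_real_add)
    then have "of_real r + a = of_real (r/2) + (of_real (r/2) + a)" by (simp only: add.assoc)
    then show ?thesis
      using assms[of "r/2"] that positive_iff[OF positive_selfadjoint[OF assms[of "r/2"]]]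
      by (simp only: half_gt_zero)
  qed
  then show ?thesis by (simp add: positive_iff[OF sa])
qed

lemma positive_antisym:
  assumes "positive a" "positive (- a :: 'a::unital_cstar_algebra)"
  shows "a = 0"
proof -
  obtain r where r: "complex_of_real r \<in> spectrum a" "\<bar>r\<bar> = norm a"
    using selfadjoint_attains_norm[OF positive_selfadjoint[OF assms(1)]] .
  have "complex_of_real (- r) \<in> spectrum (- a)"
    using spectrum_of_real_minus[of "- r" 0 a] r by simp
  then have "r = 0" using positive_spectrum r assms by (metis antisym neg_0_le_iff_le)
  then show ?thesis using r by simp
qed

lemma positive_eqI:
  assumes "positive (a - b)" "positive (b - a :: 'a::unital_cstar_algebra)"
  shows "a = b"
  using positive_antisym[of "a - b"] assms by simp

text \<open>\<open>r + a * a\<close> factors as \<open>(t - a) (- t - a)\<close> with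
  \<open>t = i * sqrt r\<close>, and neither \<open>t\<close> nor \<open>- t\<close> is
  real.\<close>

lemma positive_square:
  assumes sa: "star a = (a::'a::unital_cstar_algebra)"
  shows "positive (a * a)"
proof -
  have "is_invertible (of_real r + a * a)" if "r > 0" for r
  proof -
    define s where "s = sqrt r"
    have s: "s * s = r" "s > 0" using that by (simp_all add: s_def)
    define t where "t = \<i> * of_real s"
    have t: "t * t = of_real (- r)" using s(1) by (simp add: t_def complex_eq_iff)
    have "t \<notin> \<real>" "- t \<notin> \<real>" using s by (auto simp: t_def complex_is_Real_iff)
    then have "is_invertible (t *\<^sub>C 1 - a)" "is_invertible ((- t) *\<^sub>C 1 - a)"
      using spectrum_selfadjoint[OF sa] unfolding spectrum_def mem_Collect_eq by blast+
    then have "is_invertible ((t *\<^sub>C 1 - a) * ((- t) *\<^sub>C 1 - a))" by (rule is_invertible_mult)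
    also have "(t *\<^sub>C 1 - a) * ((- t) *\<^sub>C 1 - a) = of_real r + a * a"
      using t by (simp add: algebra_simps scaleC_simps scaleC_scaleC flip: scaleC_of_real_one)
    finally show ?thesis .
  qed
  then show ?thesis by (simp add: positive_iff star_mult sa)
qed

text \<open>Trades invertibility for a scalar lower bound, which is stable under adding positive
  elements.\<close>

lemma cone_iff:
  "a \<in> pos_def_cone \<longleftrightarrow> (\<exists>d>0. positive (a - of_real d :: 'a::unital_cstar_algebra))"
proof
  assume "a \<in> pos_def_cone"
  then have pos: "positive a" and inv: "is_invertible a" by (auto simp: pos_def_cone_def)
  define n where "n = norm (alg_inv a)"
  have "alg_inv a \<noteq> 0" using alg_inv_right[OF inv] by auto
  then have n: "n > 0" by (simp add: n_def)
  \<comment> \<open>With \<open>d\<close> the reciprocal of the norm of the inverse,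
    \<open>a - (d - r)\<close> stays invertible for \<open>0 < r \<le> d\<close> by a Neumann
    series.\<close>
  define d where "d = inverse n"
  have d: "d > 0" using n by (simp add: d_def)
  have sa: "star (a - of_real d) = a - of_real d" using positive_selfadjoint[OF pos] by (simp add: star_diff)
  have "is_invertible (of_real r + (a - of_real d))" if r: "r > 0" for r
  proof (cases "r > d")
    case True
    have "is_invertible (of_real (r - d) + a)"
      using True pos positive_iff[OF positive_selfadjoint[OF pos]] by (simp only: diff_gt_0_iff_gt)
    moreover have "of_real (r - d) + a = of_real r + (a - of_real d)" by simp
    ultimately show ?thesis by (simp only:)
  next
    case False
    have "norm (of_real (d - r) * alg_inv a) \<le> (d - r) * n"
      using False norm_mult_ineq[of "of_real (d - r)" "alg_inv a"]
      unfolding norm_of_real by (simp only: n_def abs_of_nonneg diff_ge_0_iff_ge not_less)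
    also have "\<dots> < 1" using n r by (simp add: d_def left_diff_distrib)
    finally have "is_invertible (1 - of_real (d - r) * alg_inv a)" by (rule is_invertible_neumann)
    from is_invertible_mult(1)[OF this inv]
    show ?thesis using inv by (simp add: algebra_simps alg_inv_simps mult.assoc)
  qed
  then show "\<exists>d>0. positive (a - of_real d)" using d positive_iff[OF sa] by blast
next
  assume "\<exists>d>0. positive (a - of_real d)"
  then obtain d where d: "d > 0" "positive (a - of_real d)" by blast
  have "positive a" using positive_add[OF d(2) positive_of_real[of d]] d(1) by simp
  moreover have "is_invertible (of_real d + (a - of_real d))"
    using d positive_iff[OF positive_selfadjoint[OF d(2)]] by blast
  ultimately show "a \<in> pos_def_cone" by (simp add: pos_def_cone_def)
qed

section \<open>Closure properties of the positive definite cone\<close>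

lemma cone_positive: "a \<in> pos_def_cone \<Longrightarrow> positive a"
  and cone_invertible: "a \<in> pos_def_cone \<Longrightarrow> is_invertible a"
  and cone_selfadjoint: "a \<in> pos_def_cone \<Longrightarrow> star a = a"
  by (simp_all add: pos_def_cone_def positive_def)

lemma cone_add:
  assumes "a \<in> pos_def_cone" "positive (b::'a::unital_cstar_algebra)"
  shows "a + b \<in> pos_def_cone" "b + a \<in> pos_def_cone"
proof -
  obtain d where "d > 0" "positive (a - of_real d)" using assms(1) cone_iff by blast
  then show "a + b \<in> pos_def_cone" using positive_add[OF _ assms(2), of "a - of_real d"]
    unfolding cone_iff by (auto simp: algebra_simps intro!: exI[of _ d])
  then show "b + a \<in> pos_def_cone" by (simp add: add.commute)
qed

lemma cone_of_real: "0 < r \<Longrightarrow> of_real r \<in> (pos_def_cone :: 'a::unital_cstar_algebra set)"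
  by (simp add: pos_def_cone_def positive_of_real is_invertible_of_real)

lemma cone_one: "1 \<in> (pos_def_cone :: 'a::unital_cstar_algebra set)"
  using cone_of_real[of 1] by simp

lemma cone_scaleR:
  assumes "0 < r" "a \<in> pos_def_cone"
  shows "r *\<^sub>R a \<in> (pos_def_cone :: 'a::unital_cstar_algebra set)"
proof -
  have "is_invertible (r *\<^sub>R a)"
    using assms is_invertible_scaleC[of "complex_of_real r" a] by (simp add: scaleC_of_real cone_invertible)
  then show ?thesis using assms by (simp add: pos_def_cone_def positive_scaleR)
qed

lemma cone_shift:
  assumes "star a = (a::'a::unital_cstar_algebra)" "norm a < r"
  shows "a + of_real r \<in> pos_def_cone" "of_real r - a \<in> pos_def_cone"
proof -
  have *: "b + of_real r \<in> pos_def_cone" if "star b = b" "norm b < r" for b :: 'a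
  proof -
    have "positive (of_real (norm b) + b)"
      by (rule positiveI_norm[where r = "norm b"]) (use that in \<open>auto simp: star_add\<close>)
    moreover have "b + of_real r = of_real (r - norm b) + (of_real (norm b) + b)" by simp
    ultimately show ?thesis
      using cone_add(1)[OF cone_of_real[of "r - norm b"], of "of_real (norm b) + b"] that(2) by (simp only: diff_gt_0_iff_gt)
  qed
  show "a + of_real r \<in> pos_def_cone" "of_real r - a \<in> pos_def_cone"
    using *[of a] *[of "- a"] assms by simp_all
qed

section \<open>Square roots and congruences\<close>

text \<open>Positivity follows from the factorization
  \<open>r + a^-1 = r (1/r + a) a^-1\<close>.\<close>

lemma cone_alg_inv:
  assumes "a \<in> pos_def_cone"
  shows "alg_inv a \<in> (pos_def_cone :: 'a::unital_cstar_algebra set)"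
proof -
  note inv = cone_invertible[OF assms]
  have sa: "star (alg_inv a) = alg_inv a"
    using inv assms by (simp add: star_alg_inv cone_selfadjoint)
  have "is_invertible (of_real r + alg_inv a)" if r: "r > 0" for r
  proof -
    have "is_invertible (of_real r * (of_real (inverse r) + a) * alg_inv a)"
      using r positive_iff[OF cone_selfadjoint[OF assms]] cone_positive[OF assms]
      by (intro is_invertible_mult(1) is_invertible_of_real is_invertible_alg_inv inv) auto
    also have "of_real r * (of_real (inverse r) + a) * alg_inv a = of_real r + alg_inv a"
      using inv r by (simp add: distrib_left distrib_right mult.assoc alg_inv_simps
          flip: of_real_mult mult.assoc)
        (simp add: mult.assoc alg_inv_simps)
    finally show ?thesis .
  qed
  then show ?thesis using sa inv by (simp add: pos_def_cone_def positive_iff is_invertible_alg_inv)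
qed

text \<open>With \<open>c = 1 - x / K\<close> of norm below 1, the contraction
  \<open>y \<mapsto> (c + y * y) / 2\<close> has a fixed point, and \<open>1 - y\<close> is then a
  root of \<open>x / K\<close>. Commutation with whatever commutes with \<open>x\<close> is built
  into the closed set \<open>S\<close>, so the fixed point inherits it.\<close>

lemma cone_sqrt_exists:
  fixes x :: "'a::unital_cstar_algebra"
  assumes x: "x \<in> pos_def_cone"
  obtains r where "r \<in> pos_def_cone" "r * r = x" "\<And>y. x * y = y * x \<Longrightarrow> r * y = y * r"
proof -
  obtain d where d: "d > 0" "positive (x - of_real d)" using x cone_iff by blast
  define R where "R = norm (x - of_real d)"
  \<comment> \<open>This makes \<open>c\<close> equal to \<open>(R - (x - d)) / K\<close>, of norm
    at most \<open>q = R / K\<close>; the margin \<open>d\<close> gives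
    \<open>q < 1\<close>.\<close>
  define K where "K = R + d"
  have K: "K > 0" "R \<ge> 0" using d(1) by (auto simp: K_def R_def add_nonneg_pos)
  define c where "c = 1 - (1 / K) *\<^sub>R x"
  define q where "q = R / K"
  have q: "0 \<le> q" "q < 1" using K d(1) by (simp_all add: q_def K_def)
  have sac: "star c = c" using cone_selfadjoint[OF x] by (simp add: c_def star_diff star_scaleR)
  have "norm (of_real R - (x - of_real d)) \<le> R"
    using positive_norm_bound[OF d(2)] by (simp add: R_def)
  moreover have "c = (1 / K) *\<^sub>R (of_real R - (x - of_real d))"
    using K by (simp add: c_def K_def of_real_def algebra_simps flip: scaleR_add_left)
  ultimately have nc: "norm c \<le> q" using K by (simp add: q_def divide_right_mono)
  define S where "S = {y. star y = y \<and> norm y \<le> q \<and> (\<forall>w. x * w = w * x \<longrightarrow> y * w = w * y)}"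
  define F where "F y = (1 / 2) *\<^sub>R (c + y * y)" for y
  have SD: "star y = y" "norm y \<le> q" "\<And>w. x * w = w * x \<Longrightarrow> y * w = w * y" if "y \<in> S" for y
    using that unfolding S_def by blast+
  have "closed S"
  proof -
    have cs: "continuous_on UNIV (star :: 'a \<Rightarrow> 'a)"
      by (rule lipschitz_on_continuous_on[where L = 1], rule lipschitz_onI)
        (auto simp: dist_norm simp flip: star_diff)
    have "S = {y. star y = y} \<inter> {y. norm y \<le> q} \<inter> (\<Inter>w\<in>{w. x * w = w * x}. {y. y * w = w * y})"
      by (auto simp: S_def)
    also have "closed \<dots>"
      by (intro closed_Int closed_INT ballI closed_Collect_eq closed_Collect_le continuous_intros cs)
    finally show ?thesis .
  qed
  then have "complete S" by (simp add: complete_eq_closed)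
  moreover have "S \<noteq> {}" using q by (auto simp: S_def intro!: exI[of _ 0])
  moreover have "F ` S \<subseteq> S"
  proof
    fix z assume "z \<in> F ` S"
    then obtain y where y: "y \<in> S" "z = F y" by blast
    have "norm z \<le> 1/2 * (norm c + norm y * norm y)"
      unfolding y(2) F_def using norm_triangle_ineq[of c "y * y"] norm_mult_ineq[of y y] by simp
    also have "\<dots> \<le> 1/2 * (q + 1 * q)"
      using nc SD(2)[OF y(1)] q by (intro mult_left_mono add_mono mult_mono) auto
    finally have "norm z \<le> q" by simp
    moreover have "star z = z" unfolding y(2) by (simp add: SD(1)[OF y(1)] F_def star_scaleR star_add star_mult sac)
    moreover have "z * w = w * z" if w: "x * w = w * x" for w
    proof -
      have "y * w = w * y" using SD(3)[OF y(1) w] .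
      then have "y * (y * w) = w * (y * y)" by (metis mult.assoc)
      then show ?thesis unfolding y(2) F_def c_def using w
        by (simp add: algebra_simps)
    qed
    ultimately show "z \<in> S" unfolding S_def by blast
  qed
  moreover have "dist (F y) (F z) \<le> q * dist y z" if "y \<in> S" "z \<in> S" for y z
  proof -
    have "F y - F z = (1/2) *\<^sub>R (y * (y - z) + (y - z) * z)"
      by (simp add: F_def algebra_simps)
    then have "dist (F y) (F z) \<le> 1/2 * (norm y * norm (y - z) + norm (y - z) * norm z)"
      using norm_triangle_mono[OF norm_mult_ineq[of y "y - z"] norm_mult_ineq[of "y - z" z]]
      by (simp add: dist_norm)
    also have "\<dots> \<le> 1/2 * (q * norm (y - z) + norm (y - z) * q)"
      using that SD(2) by (intro mult_left_mono add_mono mult_right_mono mult_mono) auto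
    finally show ?thesis by (simp add: dist_norm)
  qed
  ultimately obtain y where y: "y \<in> S" "F y = y"
    using Banach_fix[of S q F] q by blast
  have "(1 - y) * (1 - y) = 1 - c"
  proof -
    have "c + y * y = y + y" using y(2) scaleR_half_double[of y] unfolding F_def
      by (metis scaleR_2 scaleR_half_double scaleR_left_commute scaleR_add_right)
    then show ?thesis by (simp add: algebra_simps)
  qed
  then have sq: "(1 - y) * (1 - y) = (1 / K) *\<^sub>R x" by (simp add: c_def)
  have cone: "1 - y \<in> pos_def_cone"
    using cone_shift(2)[of y 1] SD(1,2)[OF y(1)] q by simp
  define r where "r = sqrt K *\<^sub>R (1 - y)"
  show thesis
  proof (rule that[of r])
    show "r \<in> pos_def_cone" using cone K by (simp add: r_def cone_scaleR)
    show "r * r = x" using K sq by (simp add: r_def)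
    show "r * w = w * r" if "x * w = w * x" for w
      using SD(3)[OF y(1) that] by (simp add: r_def algebra_simps)
  qed
qed

text \<open>The root \<open>t\<close> supplied by existence commutes with any positive root
  \<open>u\<close>, so \<open>(t - u) (t + u) = 0\<close> with \<open>t + u\<close>
  invertible.\<close>

lemma cone_sqrt_unique:
  fixes r s :: "'a::unital_cstar_algebra"
  assumes x: "s * s \<in> pos_def_cone" and r: "positive r" and s: "positive s" and eq: "r * r = s * s"
  shows "r = s"
proof -
  obtain t where t: "t \<in> pos_def_cone" "t * t = s * s" "\<And>y. s * s * y = y * (s * s) \<Longrightarrow> t * y = y * t"
    using cone_sqrt_exists[OF x] by metis
  have *: "u = t" if u: "positive u" "u * u = s * s" for u
  proof -
    have "t * u = u * t" using u t(3)[of u] by (metis mult.assoc)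
    then have "(t - u) * (t + u) = 0" using t(2) u(2) by (simp add: algebra_simps)
    moreover have "is_invertible (t + u)" using t(1) u(1) by (intro cone_invertible cone_add)
    ultimately have "t - u = 0" by (metis alg_inv_right mult.assoc mult.right_neutral mult_zero_left)
    then show ?thesis by simp
  qed
  show ?thesis using *[OF r eq] *[OF s refl] by simp
qed

lemma pos_sqrt_cone:
  fixes x :: "'a::unital_cstar_algebra"
  assumes "x \<in> pos_def_cone"
  shows "pos_sqrt x \<in> pos_def_cone" "pos_sqrt x * pos_sqrt x = x"
    "x * y = y * x \<Longrightarrow> pos_sqrt x * y = y * pos_sqrt x"
proof -
  obtain r where r: "r \<in> pos_def_cone" "r * r = x" "\<And>y. x * y = y * x \<Longrightarrow> r * y = y * r"
    using cone_sqrt_exists[OF assms] by metis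
  have "pos_sqrt x = r"
    unfolding pos_sqrt_def
  proof (rule the_equality)
    show "positive r \<and> r * r = x" using r(1,2) by (simp add: cone_positive)
    show "b = r" if "positive b \<and> b * b = x" for b
      using that cone_sqrt_unique[of r b] r(1,2) assms by (simp add: cone_positive)
  qed
  then show "pos_sqrt x \<in> pos_def_cone" "pos_sqrt x * pos_sqrt x = x"
    "x * y = y * x \<Longrightarrow> pos_sqrt x * y = y * pos_sqrt x" using r by blast+
qed

lemma positive_congruence:
  fixes c p :: "'a::unital_cstar_algebra"
  assumes sa: "star c = c" and p: "positive p"
  shows "positive (c * p * c)"
proof -
  text \<open>For invertible \<open>p = h\<^sup>2\<close>, invertibility of \<open>r + (c h) (h c)\<close> is that of
    \<open>r + h c\<^sup>2 h = h (r h\<^sup>-\<^sup>2 + c\<^sup>2) h\<close>.\<close>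
  have cone: "positive (c * k * c)" if k: "k \<in> pos_def_cone" for k
  proof -
    obtain h where h: "h \<in> pos_def_cone" "h * h = k" using cone_sqrt_exists[OF k] by metis
    have "is_invertible (of_real r + c * k * c)" if r: "r > 0" for r
    proof -
      have "r *\<^sub>R alg_inv k + c * c \<in> pos_def_cone"
        using k r sa by (intro cone_add(1) cone_scaleR cone_alg_inv positive_square)
      then have "is_invertible (h * (r *\<^sub>R alg_inv k + c * c) * h)"
        using h by (intro is_invertible_mult(1) cone_invertible)
      also have "h * (r *\<^sub>R alg_inv k + c * c) * h = of_real r + (h * c) * (c * h)"
      proof -
        have "h * alg_inv k * h = 1"
          using h is_invertible_mult(2)[of h h] cone_invertible[OF h(1)]
          by (simp add: mult.assoc alg_inv_simps flip: h(2))
        then show ?thesis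
          by (simp add: distrib_left distrib_right of_real_def mult.assoc)
      qed
      finally have "is_invertible (of_real r + (c * h) * (h * c))"
        using r is_invertible_swap[of r "h * c" "c * h"] by simp
      then show ?thesis by (simp add: mult.assoc flip: h(2))
    qed
    moreover have "star (c * k * c) = c * k * c"
      using sa cone_selfadjoint[OF k] by (simp add: star_mult mult.assoc)
    ultimately show ?thesis by (simp add: positive_iff)
  qed
  show ?thesis
  proof (rule positive_closed)
    fix e :: real assume e: "0 < e"
    \<comment> \<open>Adding \<open>e / n\<close> moves \<open>p\<close> into the cone; the surplus
      \<open>(e / n) c^2\<close> is completed to the scalar \<open>e\<close> by the positive element
      \<open>(e / n) (n - c^2)\<close>.\<close>
    define n where "n = norm (c * c) + 1"
    have n: "n > 0" by (simp add: n_def add_nonneg_pos)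
    have "positive (c * (of_real (e / n) + p) * c)"
      using e n p by (intro cone cone_add(1) cone_of_real) auto
    moreover have "positive ((e / n) *\<^sub>R (of_real n - c * c))"
      using e n sa by (intro positive_scaleR cone_positive cone_shift(2)) (auto simp: n_def star_mult)
    ultimately have "positive (c * (of_real (e / n) + p) * c + (e / n) *\<^sub>R (of_real n - c * c))"
      by (rule positive_add)
    also have "c * (of_real (e / n) + p) * c + (e / n) *\<^sub>R (of_real n - c * c) = of_real e + c * p * c"
      using n by (simp add: of_real_def algebra_simps)
    finally show "positive (of_real e + c * p * c)" .
  qed
qed

lemma cone_congruence:
  fixes c p :: "'a::unital_cstar_algebra"
  assumes "c \<in> pos_def_cone" "p \<in> pos_def_cone"
  shows "c * p * c \<in> pos_def_cone"
  using assms positive_congruence[OF cone_selfadjoint[OF assms(1)] cone_positive[OF assms(2)]]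
  by (simp add: pos_def_cone_def is_invertible_mult(1))

lemma positive_congruence_iff:
  fixes c p :: "'a::unital_cstar_algebra"
  assumes "c \<in> pos_def_cone"
  shows "positive (c * p * c) \<longleftrightarrow> positive p"
proof
  assume "positive (c * p * c)"
  then have "positive (alg_inv c * (c * p * c) * alg_inv c)"
    using positive_congruence[OF cone_selfadjoint[OF cone_alg_inv[OF assms]]] by blast
  moreover have "alg_inv c * (c * p * c) * alg_inv c = p"
    using cone_invertible[OF assms] by (simp add: mult.assoc alg_inv_simps)
  ultimately show "positive p" by simp
qed (use assms in \<open>intro positive_congruence cone_selfadjoint\<close>)

text \<open>The product equals the congruence \<open>r v r\<close> for a root \<open>r\<close> of
  \<open>x\<close> that commutes with \<open>v\<close>.\<close>

lemma positive_commuting_mult: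
  fixes x v :: "'a::unital_cstar_algebra"
  assumes "x \<in> pos_def_cone" "positive v" "x * v = v * x"
  shows "positive (x * v)"
proof -
  obtain r where r: "r \<in> pos_def_cone" "r * r = x" "r * v = v * r"
    using cone_sqrt_exists[OF assms(1)] assms(3) by metis
  have "positive (r * v * r)" using r assms by (intro positive_congruence cone_selfadjoint)
  also have "r * v * r = x * v" using r by (metis mult.assoc)
  finally show ?thesis .
qed

section \<open>Order gauge and reflections\<close>

lemma spectral_seminorm_selfadjoint:
  assumes "star h = (h::'a::unital_cstar_algebra)"
  shows "spectral_seminorm h = norm h"
proof -
  obtain r where r: "complex_of_real r \<in> spectrum h" "\<bar>r\<bar> = norm h"
    using selfadjoint_attains_norm[OF assms] .
  have "norm h \<in> {cmod t |t. t \<in> spectrum h}"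
    using r by (auto intro!: exI[of _ "complex_of_real r"])
  then show ?thesis unfolding spectral_seminorm_def
    by (rule cSup_eq_maximum) (auto intro: spectrum_bound)
qed

lemma norm_le_iff_positive:
  assumes "positive (h::'a::unital_cstar_algebra)"
  shows "norm h \<le> t \<longleftrightarrow> positive (of_real t - h)"
proof
  assume "norm h \<le> t"
  then show "positive (of_real t - h)"
    using assms by (intro positiveI_norm[where r = t]) (auto simp: star_diff positive_selfadjoint)
next
  assume pos: "positive (of_real t - h)"
  obtain r where r: "complex_of_real r \<in> spectrum h" "\<bar>r\<bar> = norm h"
    using selfadjoint_attains_norm[OF positive_selfadjoint[OF assms]] .
  have "0 \<le> r" using positive_spectrum[OF assms r(1)] .
  moreover have "complex_of_real (t - r) \<in> spectrum (of_real t - h)"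
    using r(1) by (simp add: spectrum_of_real_minus del: of_real_diff)
  then have "0 \<le> t - r" using positive_spectrum[OF pos] by blast
  ultimately show "norm h \<le> t" using r by simp
qed

text \<open>On the cone this is the least \<open>t\<close> with \<open>x \<le> t y\<close>
  (\<open>gauge_ratio_le_iff\<close>), a multiplicative, asymmetric distance. The spectral form
  makes its behaviour under inverses and congruences a matter of similarity.\<close>

definition gauge_ratio :: "'a::unital_cstar_algebra \<Rightarrow> 'a \<Rightarrow> real" where
  "gauge_ratio x y = spectral_seminorm (x * alg_inv y)"

lemma spectral_seminorm_similar:
  "is_invertible c \<Longrightarrow> spectral_seminorm (c * a * alg_inv c) = spectral_seminorm (a::'a::unital_cstar_algebra)"
  by (simp add: spectral_seminorm_def spectrum_similar)

text \<open>With \<open>s\<close> a root of \<open>y\<close> and \<open>h = s^-1 x s^-1\<close>, the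
  quotient is similar to the positive element \<open>h\<close>, so its spectral seminorm is a
  norm.\<close>

lemma gauge_ratio_conjugate:
  fixes x y :: "'a::unital_cstar_algebra"
  assumes "x \<in> pos_def_cone" "y \<in> pos_def_cone"
  obtains s h where "s \<in> pos_def_cone" "h \<in> pos_def_cone" "s * s = y" "x = s * h * s"
    "x * alg_inv y = s * h * alg_inv s" "gauge_ratio x y = norm h"
proof -
  obtain s where s: "s \<in> pos_def_cone" "s * s = y" using cone_sqrt_exists[OF assms(2)] by metis
  note inv = cone_invertible[OF s(1)]
  define h where "h = alg_inv s * x * alg_inv s"
  have h: "h \<in> pos_def_cone" using s assms by (simp add: h_def cone_congruence cone_alg_inv)
  have x: "x = s * h * s" using inv by (simp add: h_def mult.assoc alg_inv_simps)
  have xy: "x * alg_inv y = s * h * alg_inv s"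
    using inv by (simp add: h_def mult.assoc alg_inv_simps is_invertible_mult flip: s(2))
  have "gauge_ratio x y = norm h"
    unfolding gauge_ratio_def xy
    using inv h by (simp add: spectral_seminorm_similar spectral_seminorm_selfadjoint cone_selfadjoint)
  then show thesis using that s h x xy by blast
qed

lemma gauge_ratio_le_iff:
  fixes x y :: "'a::unital_cstar_algebra"
  assumes "x \<in> pos_def_cone" "y \<in> pos_def_cone"
  shows "gauge_ratio x y \<le> t \<longleftrightarrow> positive (t *\<^sub>R y - x)"
proof -
  obtain s h where s: "s \<in> pos_def_cone" "h \<in> pos_def_cone" "s * s = y" "x = s * h * s"
    "gauge_ratio x y = norm h"
    using gauge_ratio_conjugate[OF assms] by metis
  have "t *\<^sub>R y - x = s * (of_real t - h) * s"
    by (simp add: s(4) of_real_def algebra_simps flip: s(3))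
  then show ?thesis
    using positive_congruence_iff[OF s(1)] norm_le_iff_positive[OF cone_positive[OF s(2)]] s(5) by simp
qed

lemma gauge_ratio_pos:
  fixes x y :: "'a::unital_cstar_algebra"
  assumes "x \<in> pos_def_cone" "y \<in> pos_def_cone"
  shows "0 < gauge_ratio x y"
proof -
  obtain h :: 'a where h: "h \<in> pos_def_cone" "gauge_ratio x y = norm h"
    using gauge_ratio_conjugate[OF assms] by metis
  have "h \<noteq> 0" using alg_inv_right[OF cone_invertible[OF h(1)]] by auto
  then show ?thesis using h by simp
qed

lemma gauge_ratio_self: "x \<in> pos_def_cone \<Longrightarrow> gauge_ratio x x = (1::real)"
  for x :: "'a::unital_cstar_algebra"
  by (simp add: gauge_ratio_def cone_invertible alg_inv_simps spectral_seminorm_selfadjoint)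

lemma gauge_ratio_triangle:
  fixes x y z :: "'a::unital_cstar_algebra"
  assumes "x \<in> pos_def_cone" "y \<in> pos_def_cone" "z \<in> pos_def_cone"
  shows "gauge_ratio x z \<le> gauge_ratio x y * gauge_ratio y z"
proof -
  let ?s = "gauge_ratio x y" and ?t = "gauge_ratio y z"
  have "positive (?s *\<^sub>R y - x)" "positive (?t *\<^sub>R z - y)"
    using assms by (simp_all flip: gauge_ratio_le_iff)
  then have "positive ((?s *\<^sub>R y - x) + ?s *\<^sub>R (?t *\<^sub>R z - y))"
    using gauge_ratio_pos[of x y] assms by (intro positive_add positive_scaleR) auto
  then show ?thesis using assms by (simp add: gauge_ratio_le_iff algebra_simps)
qed

lemma gauge_ratio_antisym:
  fixes x y :: "'a::unital_cstar_algebra"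
  assumes "x \<in> pos_def_cone" "y \<in> pos_def_cone" "gauge_ratio x y \<le> 1" "gauge_ratio y x \<le> 1"
  shows "x = y"
  using assms by (intro positive_eqI) (simp_all add: gauge_ratio_le_iff)

lemma gauge_ratio_alg_inv:
  fixes x y :: "'a::unital_cstar_algebra"
  assumes "x \<in> pos_def_cone" "y \<in> pos_def_cone"
  shows "gauge_ratio (alg_inv x) (alg_inv y) = gauge_ratio y x"
  using spectral_seminorm_similar[OF cone_invertible[OF assms(1)], of "alg_inv x * y"] assms
  by (simp add: gauge_ratio_def alg_inv_alg_inv cone_invertible alg_inv_simps mult.assoc)

lemma gauge_ratio_congruence:
  fixes x y z :: "'a::unital_cstar_algebra"
  assumes "is_invertible z" "y \<in> pos_def_cone"
  shows "gauge_ratio (z * x * z) (z * y * z) = gauge_ratio x y"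
  using spectral_seminorm_similar[OF assms(1), of "x * alg_inv y"] assms
  by (simp add: gauge_ratio_def cone_invertible is_invertible_mult alg_inv_simps mult.assoc)

text \<open>\<open>z u^-1 z u^-1\<close> is the square of \<open>z u^-1\<close>, hence similar to
  \<open>h * h\<close> with \<open>h\<close> self-adjoint.\<close>

lemma gauge_ratio_reflection:
  fixes u z :: "'a::unital_cstar_algebra"
  assumes "z \<in> pos_def_cone" "u \<in> pos_def_cone"
  shows "gauge_ratio (z * alg_inv u * z) u = (gauge_ratio z u)\<^sup>2"
proof -
  obtain s h where s: "s \<in> pos_def_cone" "h \<in> pos_def_cone"
    "z * alg_inv u = s * h * alg_inv s" "gauge_ratio z u = norm h"
    using gauge_ratio_conjugate[OF assms] by metis
  note inv = cone_invertible[OF s(1)]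
  have "z * alg_inv u * z * alg_inv u = (z * alg_inv u) * (z * alg_inv u)" by (simp add: mult.assoc)
  also have "\<dots> = s * (h * h) * alg_inv s" unfolding s(3) using inv by (simp add: mult.assoc alg_inv_simps)
  finally show ?thesis
    unfolding gauge_ratio_def[of "z * alg_inv u * z"]
    using inv s by (simp add: spectral_seminorm_similar spectral_seminorm_selfadjoint
        cone_selfadjoint star_mult norm_normal_square)
qed

text \<open>
  The multiplicative form (no logarithm is taken) of a metric space with a point reflection in
  \<open>z\<close> that doubles the distance to \<open>z\<close>. The iteration in \<open>isometry_fixes_center\<close> is Vaisala's
  proof of the Mazur--Ulam theorem.
\<close>

locale reflection_space =
  fixes X :: "'a set" and d :: "'a \<Rightarrow> 'a \<Rightarrow> real" and refl :: "'a \<Rightarrow> 'a" and z :: 'a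
  assumes refl_in: "u \<in> X \<Longrightarrow> refl u \<in> X"
    and refl_refl: "u \<in> X \<Longrightarrow> refl (refl u) = u"
    and z_in: "z \<in> X"
    and d_refl: "u \<in> X \<Longrightarrow> v \<in> X \<Longrightarrow> d (refl u) (refl v) = d u v"
    and d_refl_self: "u \<in> X \<Longrightarrow> d (refl u) u = (d u z)\<^sup>2"
    and d_triangle: "u \<in> X \<Longrightarrow> v \<in> X \<Longrightarrow> w \<in> X \<Longrightarrow> d u w \<le> d u v * d v w"
    and d_self: "u \<in> X \<Longrightarrow> d u u = 1"
    and d_eq: "u \<in> X \<Longrightarrow> v \<in> X \<Longrightarrow> d u v \<le> 1 \<Longrightarrow> u = v"
begin

lemma refl_center: "refl z = z"
  using d_refl_self[OF z_in] d_self[OF z_in] by (intro d_eq refl_in z_in) simp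

lemma refl_eq_self: "u \<in> X \<Longrightarrow> refl u = u \<Longrightarrow> u = z"
  using d_refl_self[of u] d_self[of u] by (intro d_eq z_in) (auto simp: power2_eq_1_iff)

lemma refl_bij: "bij_betw refl X X"
  by (rule bij_betw_byWitness[where f' = refl]) (auto simp: refl_refl refl_in)

lemma isometry_fixes_center:
  assumes x: "x \<in> X"
    and g: "bij_betw g X X" "\<And>u v. u \<in> X \<Longrightarrow> v \<in> X \<Longrightarrow> d (g u) (g v) = d u v"
    and gx: "g x = x" "g (refl x) = refl x"
  shows "g z = z"
proof -
  define W where "W = {g. bij_betw g X X \<and> (\<forall>u\<in>X. \<forall>v\<in>X. d (g u) (g v) = d u v) \<and>
      g x = x \<and> g (refl x) = refl x}"
  \<comment> \<open>The composite of \<open>g\<close>, \<open>refl\<close>, the inverse of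
    \<open>g\<close> and \<open>refl\<close> again fixes \<open>x\<close> and \<open>refl x\<close>,
    and it squares the displacement of \<open>z\<close>.\<close>
  have step: "\<exists>g'\<in>W. d (g' z) z = (d (g z) z)\<^sup>2" if "g \<in> W" for g
  proof -
    have g: "bij_betw g X X" "\<And>u v. u \<in> X \<Longrightarrow> v \<in> X \<Longrightarrow> d (g u) (g v) = d u v"
      "g x = x" "g (refl x) = refl x"
      using that by (auto simp: W_def)
    define h where "h = inv_into X g"
    have h: "bij_betw h X X" using g(1) by (simp add: h_def bij_betw_inv_into)
    have gh: "g (h u) = u" "h u \<in> X" if "u \<in> X" for u
      using g(1) h that by (auto simp: h_def bij_betw_def f_inv_into_f)
    have gX: "g u \<in> X" if "u \<in> X" for u using g(1) that by (auto simp: bij_betw_def)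
    have hfix: "h x = x" "h (refl x) = refl x"
      using g x refl_in[OF x] by (metis bij_betw_inv_into_left h_def)+
    have dh: "d (h u) (h v) = d u v" if "u \<in> X" "v \<in> X" for u v
      using g(2)[of "h u" "h v"] gh that by simp
    define k where "k = refl \<circ> h \<circ> refl \<circ> g"
    have "bij_betw k X X" unfolding k_def by (intro bij_betw_trans[of _ _ X] g(1) h refl_bij)
    moreover have "d (k u) (k v) = d u v" if "u \<in> X" "v \<in> X" for u v
      using that by (simp add: k_def d_refl dh g(2) gX gh refl_in)
    ultimately have "k \<in> W" using g hfix x by (simp add: W_def k_def refl_refl)
    moreover have "d (k z) z = (d (g z) z)\<^sup>2"
    proof -
      have in_X: "g z \<in> X" "refl (g z) \<in> X" using gX refl_in z_in by auto
      have "d (k z) z = d (refl (h (refl (g z)))) (refl z)" by (simp add: k_def refl_center)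
      also have "\<dots> = d (h (refl (g z))) z" using in_X z_in by (simp add: d_refl gh)
      also have "\<dots> = d (refl (g z)) (g z)" using g(2)[of "h (refl (g z))" z] gh in_X z_in by simp
      also have "\<dots> = (d (g z) z)\<^sup>2" using in_X by (simp add: d_refl_self)
      finally show ?thesis .
    qed
    ultimately show ?thesis by blast
  qed
  \<comment> \<open>Members of \<open>W\<close> fix \<open>x\<close>, so they displace
    \<open>z\<close> by a uniformly bounded amount; repeated squaring then excludes any displacement
    above 1.\<close>
  have bound: "d (g z) z \<le> d z x * d x z" if "g \<in> W" for g
  proof -
    have "g z \<in> X" using that z_in by (auto simp: W_def bij_betw_def)
    then have "d (g z) z \<le> d (g z) (g x) * d x z"
      using that d_triangle[of "g z" x z] x z_in by (simp add: W_def)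
    moreover have "d (g z) (g x) = d z x" using that x z_in unfolding W_def by blast
    ultimately show ?thesis by simp
  qed
  have gW: "g \<in> W" using g gx by (simp add: W_def)
  have iter: "\<exists>g'\<in>W. d (g' z) z = d (g z) z ^ (2 ^ n)" for n
  proof (induction n)
    case 0
    then show ?case using gW by auto
  next
    case (Suc n)
    then obtain g' where "g' \<in> W" "d (g' z) z = d (g z) z ^ (2 ^ n)" by blast
    then show ?case using step[of g'] by (simp add: power_mult[symmetric] mult.commute)
  qed
  have "d (g z) z \<le> 1"
  proof (rule ccontr)
    assume "\<not> ?thesis"
    then have gt: "1 < d (g z) z" by simp
    then obtain n where n: "d z x * d x z < d (g z) z ^ n" using real_arch_pow by blast
    also have "d (g z) z ^ n \<le> d (g z) z ^ (2 ^ n)"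
      using gt by (intro power_increasing) (auto simp: less_imp_le)
    also have "\<dots> \<le> d z x * d x z" using iter[of n] bound by metis
    finally show False by simp
  qed
  then show ?thesis using g(1) z_in by (intro d_eq) (auto simp: bij_betw_def)
qed

end

text \<open>The self-map \<open>r f^-1 q f\<close> of \<open>X\<close> fixes \<open>x\<close> and
  \<open>r x\<close>, hence \<open>z\<close>. So \<open>q\<close> fixes \<open>f z\<close>, and its
  only fixed point is \<open>w\<close>.\<close>

lemma isometry_maps_center:
  assumes X: "reflection_space X d r z" and Y: "reflection_space Y e q w"
    and f: "bij_betw f X Y" and iso: "\<And>u v. u \<in> X \<Longrightarrow> v \<in> X \<Longrightarrow> e (f u) (f v) = d u v"
    and x: "x \<in> X" and qf: "q (f x) = f (r x)"
  shows "f z = w"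
proof -
  interpret X: reflection_space X d r z by (rule X)
  interpret Y: reflection_space Y e q w by (rule Y)
  define h where "h = inv_into X f"
  have h: "bij_betw h Y X" using f by (simp add: h_def bij_betw_inv_into)
  have fh: "f (h u) = u" "h u \<in> X" if "u \<in> Y" for u
    using f h that by (auto simp: h_def bij_betw_def f_inv_into_f)
  have hf: "h (f u) = u" "f u \<in> Y" if "u \<in> X" for u
    using f that by (auto simp: h_def bij_betw_def)
  have dh: "d (h u) (h v) = e u v" if "u \<in> Y" "v \<in> Y" for u v
    using iso[of "h u" "h v"] fh that by simp
  define g where "g = r \<circ> h \<circ> q \<circ> f"
  have "g z = z"
  proof (rule X.isometry_fixes_center[OF x])
    show "bij_betw g X X"
      unfolding g_def using bij_betw_trans[OF f Y.refl_bij] bij_betw_trans[OF h X.refl_bij]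
      by (metis bij_betw_trans comp_assoc)
    show "d (g u) (g v) = d u v" if "u \<in> X" "v \<in> X" for u v
      using that by (simp add: g_def X.d_refl Y.d_refl dh iso fh hf Y.refl_in)
    show "g x = x" using x by (simp add: g_def qf hf X.refl_in X.refl_refl)
    have "q (f (r x)) = f x" using x by (simp add: Y.refl_refl hf flip: qf)
    then show "g (r x) = r x" using x by (simp add: g_def hf)
  qed
  then have "r (r (h (q (f z)))) = r z" by (simp add: g_def)
  then have "h (q (f z)) = z" using X.z_in X.refl_center by (simp add: X.refl_refl fh hf Y.refl_in)
  then have "q (f z) = f z" using fh(1)[of "q (f z)"] X.z_in by (simp add: hf Y.refl_in)
  then show ?thesis using X.z_in hf by (intro Y.refl_eq_self)
qed

text \<open>The exponential of Thompson's metric. Reflections involve an inverse and so swap the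
  arguments of \<open>gauge_ratio\<close>; the symmetrization is invariant under them.\<close>

definition thompson :: "'a::unital_cstar_algebra \<Rightarrow> 'a \<Rightarrow> real" where
  "thompson x y = max (gauge_ratio x y) (gauge_ratio y x)"

lemma cone_reflection:
  fixes u z :: "'a::unital_cstar_algebra"
  assumes "z \<in> pos_def_cone" "u \<in> pos_def_cone"
  shows "z * alg_inv u * z \<in> pos_def_cone"
    "alg_inv (z * alg_inv u * z) = alg_inv z * u * alg_inv z"
    "gauge_ratio u (z * alg_inv u * z) = (gauge_ratio u z)\<^sup>2"
proof -
  show c: "z * alg_inv u * z \<in> pos_def_cone" using assms by (intro cone_congruence cone_alg_inv)
  show i: "alg_inv (z * alg_inv u * z) = alg_inv z * u * alg_inv z"
    using assms by (simp add: cone_invertible is_invertible_mult is_invertible_alg_inv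
        alg_inv_alg_inv mult.assoc)
  have "gauge_ratio u (z * alg_inv u * z) = gauge_ratio (alg_inv (z * alg_inv u * z)) (alg_inv u)"
    using assms c by (simp add: gauge_ratio_alg_inv)
  also have "\<dots> = gauge_ratio (alg_inv z * alg_inv (alg_inv u) * alg_inv z) (alg_inv u)"
    using i assms by (simp add: alg_inv_alg_inv cone_invertible)
  also have "\<dots> = (gauge_ratio (alg_inv z) (alg_inv u))\<^sup>2"
    using assms by (intro gauge_ratio_reflection cone_alg_inv)
  finally show "gauge_ratio u (z * alg_inv u * z) = (gauge_ratio u z)\<^sup>2"
    using assms by (simp add: gauge_ratio_alg_inv)
qed

lemma cone_reflection_space:
  fixes z :: "'a::unital_cstar_algebra"
  assumes z: "z \<in> pos_def_cone"
  shows "reflection_space pos_def_cone thompson (\<lambda>u. z * alg_inv u * z) z"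
proof
  note inv = cone_invertible[OF z]
  fix u v w :: 'a
  show "z \<in> pos_def_cone" by fact
  assume u: "u \<in> pos_def_cone"
  show "z * alg_inv u * z \<in> pos_def_cone" using z u by (rule cone_reflection)
  show "z * alg_inv (z * alg_inv u * z) * z = u"
    unfolding cone_reflection(2)[OF z u] using inv by (simp add: alg_inv_simps mult.assoc)
  show "thompson (z * alg_inv u * z) u = (thompson u z)\<^sup>2"
    using gauge_ratio_pos[OF z u] gauge_ratio_pos[OF u z]
    by (auto simp: thompson_def gauge_ratio_reflection cone_reflection z u max_def power_mono
        dest: power2_le_imp_le)
  show "thompson u u = 1" using u by (simp add: thompson_def gauge_ratio_self)
  assume v: "v \<in> pos_def_cone"
  show "thompson (z * alg_inv u * z) (z * alg_inv v * z) = thompson u v"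
    using u v inv by (simp add: thompson_def gauge_ratio_congruence gauge_ratio_alg_inv
        cone_alg_inv max.commute)
  show "u = v" if "thompson u v \<le> 1"
    using that u v by (intro gauge_ratio_antisym) (auto simp: thompson_def)
  assume w: "w \<in> pos_def_cone"
  have mono: "gauge_ratio a c \<le> thompson u v * thompson v w"
    if "gauge_ratio a c \<le> p * q" "0 < p" "0 < q" "p \<le> thompson u v" "q \<le> thompson v w" for a c :: 'a and p q
    using that by (meson less_imp_le mult_mono order_trans)
  show "thompson u w \<le> thompson u v * thompson v w"
    unfolding thompson_def[of u w]
  proof (rule max.boundedI)
    show "gauge_ratio u w \<le> thompson u v * thompson v w"
      using u v w by (intro mono[OF gauge_ratio_triangle[of u v w]] gauge_ratio_pos)
        (auto simp: thompson_def)
    have "gauge_ratio w u \<le> gauge_ratio v u * gauge_ratio w v"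
      using gauge_ratio_triangle[of w v u] u v w by (simp add: mult.commute)
    then show "gauge_ratio w u \<le> thompson u v * thompson v w"
      using u v w by (intro mono[of w u "gauge_ratio v u" "gauge_ratio w v"] gauge_ratio_pos)
        (auto simp: thompson_def)
  qed
qed

text \<open>The geometric mean of \<open>a\<close> and \<open>b\<close> is the centre whose
  reflection carries \<open>a\<close> to \<open>b\<close>: for \<open>a = s s\<close> and
  \<open>b = s h s\<close> it is \<open>s k s\<close> with \<open>k\<close> a root of
  \<open>h\<close>.\<close>

lemma geometric_mean_exists:
  fixes a b :: "'a::unital_cstar_algebra"
  assumes "a \<in> pos_def_cone" "b \<in> pos_def_cone"
  obtains w where "w \<in> pos_def_cone" "w * alg_inv a * w = b"
proof -
  obtain s h where s: "s \<in> pos_def_cone" "h \<in> pos_def_cone" "s * s = a" "b = s * h * s"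
    using gauge_ratio_conjugate[OF assms(2,1)] by metis
  obtain k where k: "k \<in> pos_def_cone" "k * k = h" using cone_sqrt_exists[OF s(2)] by metis
  note inv = cone_invertible[OF s(1)]
  show thesis
  proof (rule that[of "s * k * s"])
    show "s * k * s \<in> pos_def_cone" using s k by (simp add: cone_congruence)
    have "s * k * s * alg_inv a * (s * k * s) = s * (k * k) * s"
      using inv by (simp add: is_invertible_mult alg_inv_simps mult.assoc flip: s(3))
    then show "s * k * s * alg_inv a * (s * k * s) = b" using k s by simp
  qed
qed

text \<open>Choose \<open>w\<close> as the geometric mean of the images of \<open>x\<close> and of
  its reflection. The reflections in \<open>z\<close> and \<open>w\<close> then correspond at
  \<open>x\<close>, and the Mazur-Ulam argument yields \<open>f z = w\<close>.\<close>

lemma gauge_isometry_reflection: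
  fixes f :: "'a::unital_cstar_algebra \<Rightarrow> 'b::unital_cstar_algebra"
  assumes f: "bij_betw f pos_def_cone pos_def_cone"
    and iso: "\<And>x y. x \<in> pos_def_cone \<Longrightarrow> y \<in> pos_def_cone \<Longrightarrow> gauge_ratio (f x) (f y) = gauge_ratio x y"
    and x: "x \<in> pos_def_cone" and z: "z \<in> pos_def_cone"
  shows "f (z * alg_inv x * z) = f z * alg_inv (f x) * f z"
proof -
  let ?r = "\<lambda>u. z * alg_inv u * z"
  have fP: "f u \<in> pos_def_cone" if "u \<in> pos_def_cone" for u using f that by (auto simp: bij_betw_def)
  have "?r x \<in> pos_def_cone" using z x by (rule cone_reflection)
  then obtain w where w: "w \<in> pos_def_cone" "w * alg_inv (f x) * w = f (?r x)"
    using geometric_mean_exists fP x by metis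
  have "f z = w"
    using isometry_maps_center[OF cone_reflection_space[OF z] cone_reflection_space[OF w(1)] f _ x] w(2) iso
    by (simp add: thompson_def)
  then show ?thesis using w by simp
qed

section \<open>Additivity\<close>

text \<open>Completing the square gives \<open>\<alpha> (k * k + (d - c * c))\<close> with
  \<open>k = r (x - \<alpha>) - c\<close>. The coefficient \<open>1 / (4 d m^2)\<close> is large
  enough that \<open>c * c \<le> d\<close> for every \<open>\<alpha> \<ge> m\<close>.\<close>

lemma quadratic_majorant:
  fixes x :: "'a::unital_cstar_algebra"
  assumes sa: "star x = x" and m: "0 < m" "m \<le> \<alpha>" and d: "0 < d"
  shows "positive (\<alpha> *\<^sub>R (of_real (1 + d) +
    (1 / (4 * d * m\<^sup>2)) *\<^sub>R ((x - of_real \<alpha>) * (x - of_real \<alpha>))) - x)"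
proof -
  define N where "N = 1 / (4 * d * m\<^sup>2)"
  define r where "r = sqrt N"
  have N: "N > 0" using m d by (simp add: N_def)
  then have r: "r > 0" "r * r = N" by (simp_all add: r_def)
  define c where "c = 1 / (2 * r * \<alpha>)"
  have \<alpha>: "\<alpha> > 0" using m by simp
  have "c\<^sup>2 = 1 / (4 * N * \<alpha>\<^sup>2)" using r by (simp add: c_def power2_eq_square)
  also have "\<dots> = d * (m\<^sup>2 / \<alpha>\<^sup>2)" using d m by (simp add: N_def)
  also have "\<dots> \<le> d * 1" using d m \<alpha> by (intro mult_left_mono) (auto simp: power_mono)
  finally have c: "c * c \<le> d" by (simp add: power2_eq_square)
  have rc: "\<alpha> * (r * c) = 1/2" using r \<alpha> by (simp add: c_def)
  define w where "w = x - of_real \<alpha>"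
  have sw: "star w = w" using sa by (simp add: w_def star_diff)
  define k where "k = r *\<^sub>R w - of_real c"
  have "positive (\<alpha> *\<^sub>R (k * k + of_real (d - c * c)))"
    using sw c \<alpha> by (intro positive_scaleR positive_add positive_square positive_of_real)
      (auto simp: k_def star_diff star_scaleR)
  also have "\<alpha> *\<^sub>R (k * k + of_real (d - c * c)) = \<alpha> *\<^sub>R (of_real d + N *\<^sub>R (w * w)) - (2 * (\<alpha> * (r * c))) *\<^sub>R w"
    by (simp add: k_def of_real_def algebra_simps flip: r(2)) (simp flip: scaleR_left_distrib)
  also have "\<dots> = \<alpha> *\<^sub>R (of_real (1 + d) + N *\<^sub>R (w * w)) - x"
    unfolding rc by (simp add: w_def of_real_def algebra_simps)
  finally show ?thesis by (simp only: N_def w_def)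
qed

text \<open>A Bernoulli trial with operator probability \<open>U\<close>: averaging the squared
  deviation over success and failure leaves the squared mean deviation plus the variance
  \<open>U - U * U\<close>. The summand \<open>K\<close> carries the variance of earlier
  trials.\<close>

lemma variance_step:
  fixes U W K :: "'a::ring_1"
  assumes "U * W = W * U"
  shows "U * ((W - 1) * (W - 1) + K) + (1 - U) * (W * W + K) = (W - U) * (W - U) + (U - U * U) + K"
  using assms by (simp add: algebra_simps)

text \<open>
  Averaging the hypothesis over the nodes \<open>i/n\<close> with the Bernstein weights
  \<open>(n choose i) U\<^sup>i (1 - U)\<^sup>n\<^sup>-\<^sup>i\<close> bounds \<open>v\<close> by the variance \<open>N U (1 - U) / n\<close>. The weights are
  never written down: the induction performs the averaging one Bernoulli step at a time.
\<close>

lemma nonpositive_if_below_parabolas: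
  fixes U v :: "'a::unital_cstar_algebra"
  assumes U: "U \<in> pos_def_cone" "1 - U \<in> pos_def_cone"
    and comm: "U * v = v * U" and N: "0 \<le> N"
    and le: "\<And>\<alpha>. 0 \<le> \<alpha> \<Longrightarrow> \<alpha> \<le> 1 \<Longrightarrow> positive (N *\<^sub>R ((U - of_real \<alpha>) * (U - of_real \<alpha>)) - v)"
  shows "positive (- v)"
proof -
  define V where "V = U - U * U"
  have var: "positive ((N / n) *\<^sub>R V - v)" if n: "n > 0" for n :: nat
  proof -
    \<comment> \<open>Of \<open>n\<close> trials, \<open>j\<close> have been averaged and
      \<open>s\<close> of the others succeeded: \<open>W j s\<close> is \<open>n U\<close> minus the
      resulting mean number of successes, and \<open>j V\<close> in \<open>E j s\<close> is the
      accumulated variance. Everything is scaled by \<open>n\<close>, so \<open>E 0 s\<close> is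
      \<open>n^2\<close> times the hypothesis at the node \<open>s / n\<close>.\<close>
    define W where "W j s = (real n - real j) *\<^sub>R U - of_real (real s)" for j s :: nat
    define E where "E j s = N *\<^sub>R (W j s * W j s + real j *\<^sub>R V) - (real n)\<^sup>2 *\<^sub>R v" for j s :: nat
    have "\<forall>s. s + j \<le> n \<longrightarrow> positive (E j s)" if "j \<le> n" for j
      using that
    proof (induction j)
      case 0
      have "positive (E 0 s)" if "s \<le> n" for s
      proof -
        define D where "D = U - of_real (s / n)"
        have "W 0 s = real n *\<^sub>R D"
          using n by (simp add: D_def W_def of_real_def algebra_simps)
        then have E0: "E 0 s = (real n)\<^sup>2 *\<^sub>R (N *\<^sub>R (D * D) - v)"
          by (simp add: E_def scaleR_right_diff_distrib power2_eq_square mult_ac)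
        have "positive (N *\<^sub>R (D * D) - v)"
          unfolding D_def using that n by (intro le) auto
        then show ?thesis unfolding E0 by (intro positive_scaleR) auto
      qed
      then show ?case by simp
    next
      case (Suc j)
      have "positive (E (Suc j) s)" if s: "s + Suc j \<le> n" for s
      proof -
        have WU: "U * W j t = W j t * U" for t by (simp add: W_def algebra_simps of_real_def)
        have VU: "U * V = V * U" by (simp add: V_def algebra_simps)
        have EU: "U * E j t = E j t * U" for t
          unfolding E_def using WU[of t] VU comm
          by (simp add: distrib_left distrib_right left_diff_distrib right_diff_distrib)
            (metis mult.assoc)
        have W1: "W j (Suc s) = W j s - 1" by (simp add: W_def of_real_def algebra_simps)
        have W2: "W (Suc j) s = W j s - U" by (simp add: W_def algebra_simps)
        have "U * (W j (Suc s) * W j (Suc s) + real j *\<^sub>R V) + (1 - U) * (W j s * W j s + real j *\<^sub>R V)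
          = W (Suc j) s * W (Suc j) s + real (Suc j) *\<^sub>R V"
          unfolding W1 W2 variance_step[OF WU] by (simp add: V_def algebra_simps)
        moreover have "N *\<^sub>R (U * A + (1 - U) * B) - k *\<^sub>R v =
            U * (N *\<^sub>R A - k *\<^sub>R v) + (1 - U) * (N *\<^sub>R B - k *\<^sub>R v)" for A B :: 'a and k
          by (simp add: algebra_simps)
        ultimately have "E (Suc j) s = U * E j (Suc s) + (1 - U) * E j s"
          unfolding E_def by metis
        moreover have "positive (E j (Suc s))" "positive (E j s)" using Suc s by auto
        then have "positive (U * E j (Suc s) + (1 - U) * E j s)"
          using U EU by (intro positive_add positive_commuting_mult) (auto simp: algebra_simps)
        ultimately show ?thesis by simp
      qed
      then show ?case by blast
    qed
    then have "positive (E n 0)" by simp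
    also have "E n 0 = (real n)\<^sup>2 *\<^sub>R ((N / n) *\<^sub>R V - v)"
      using n by (simp add: E_def W_def scaleR_right_diff_distrib power2_eq_square)
    finally show ?thesis using n by (simp add: positive_scaleR_iff)
  qed
  show ?thesis
  proof (rule positive_closed)
    fix e :: real assume e: "0 < e"
    obtain n :: nat where n: "N * norm V / e < n" using reals_Archimedean2 by blast
    have "0 \<le> N * norm V / e" using N e by simp
    with n have n0: "n > 0" by (metis less_nat_zero_code not_gr_zero of_nat_0 order_le_less_trans order_less_irrefl)
    have "norm ((N / n) *\<^sub>R V) < e" using n n0 e N by (simp add: field_simps)
    moreover have "star ((N / n) *\<^sub>R V) = (N / n) *\<^sub>R V"
      using cone_selfadjoint[OF U(1)] by (simp add: V_def star_scaleR star_diff star_mult)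
    ultimately have "positive (of_real e - (N / n) *\<^sub>R V)" by (intro cone_positive cone_shift(2))
    then have "positive ((of_real e - (N / n) *\<^sub>R V) + ((N / n) *\<^sub>R V - v))"
      using var[OF n0] by (rule positive_add)
    then show "positive (of_real e + - v)" by simp
  qed
qed

section \<open>Unital gauge isometries of the cone\<close>

locale unital_gauge_isometry =
  fixes f :: "'a::unital_cstar_algebra \<Rightarrow> 'b::unital_cstar_algebra"
  assumes bij: "bij_betw f pos_def_cone pos_def_cone"
    and gauge: "x \<in> pos_def_cone \<Longrightarrow> y \<in> pos_def_cone \<Longrightarrow> gauge_ratio (f x) (f y) = gauge_ratio x y"
    and one: "f 1 = 1"
begin

lemma in_cone: "x \<in> pos_def_cone \<Longrightarrow> f x \<in> pos_def_cone"
  using bij by (auto simp: bij_betw_def)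

lemma surj_cone:
  assumes "y \<in> pos_def_cone"
  obtains x where "x \<in> pos_def_cone" "y = f x"
  using assms bij by (auto simp: bij_betw_def)

lemma inverse_isometry:
  "unital_gauge_isometry (inv_into pos_def_cone f)"
  "x \<in> pos_def_cone \<Longrightarrow> inv_into pos_def_cone f (f x) = x"
  "y \<in> pos_def_cone \<Longrightarrow> f (inv_into pos_def_cone f y) = y"
proof -
  show inv: "inv_into pos_def_cone f (f x) = x" if "x \<in> pos_def_cone" for x
    using bij that by (auto simp: bij_betw_def)
  show inv': "f (inv_into pos_def_cone f y) = y" if "y \<in> pos_def_cone" for y
    using bij that by (auto simp: bij_betw_def f_inv_into_f)
  show "unital_gauge_isometry (inv_into pos_def_cone f)"
  proof
    show b: "bij_betw (inv_into pos_def_cone f) pos_def_cone pos_def_cone"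
      using bij by (rule bij_betw_inv_into)
    then have "inv_into pos_def_cone f u \<in> pos_def_cone" if "u \<in> pos_def_cone" for u
      using that by (auto simp: bij_betw_def)
    then show "gauge_ratio (inv_into pos_def_cone f x) (inv_into pos_def_cone f y) = gauge_ratio x y"
      if "x \<in> pos_def_cone" "y \<in> pos_def_cone" for x y
      using gauge[of "inv_into pos_def_cone f x" "inv_into pos_def_cone f y"] that by (simp add: inv')
    show "inv_into pos_def_cone f 1 = 1" using inv[OF cone_one] one by simp
  qed
qed

lemma reflection:
  assumes "x \<in> pos_def_cone" "z \<in> pos_def_cone"
  shows "f (z * alg_inv x * z) = f z * alg_inv (f x) * f z"
  using bij gauge assms by (rule gauge_isometry_reflection)

lemma alg_inv_map: "x \<in> pos_def_cone \<Longrightarrow> f (alg_inv x) = alg_inv (f x)"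
  using reflection[of x 1] by (simp add: cone_one one)

text \<open>This is the reflection of \<open>alg_inv y\<close> in \<open>x\<close>.\<close>

lemma triple:
  assumes "x \<in> pos_def_cone" "y \<in> pos_def_cone"
  shows "f (x * y * x) = f x * f y * f x"
  using reflection[of "alg_inv y" x] assms
  by (simp add: cone_alg_inv alg_inv_alg_inv cone_invertible alg_inv_map in_cone)

lemma square: "x \<in> pos_def_cone \<Longrightarrow> f (x * x) = f x * f x"
  using triple[of x 1] by (simp add: cone_one one)

lemma order_iff:
  assumes "x \<in> pos_def_cone" "y \<in> pos_def_cone"
  shows "positive (t *\<^sub>R f y - f x) \<longleftrightarrow> positive (t *\<^sub>R y - x)"
  using assms gauge by (simp add: in_cone flip: gauge_ratio_le_iff)

lemma mono_iff:
  assumes "x \<in> pos_def_cone" "y \<in> pos_def_cone"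
  shows "positive (f y - f x) \<longleftrightarrow> positive (y - x)"
  using order_iff[OF assms, of 1] by simp

text \<open>The two inequalities compare \<open>x\<close> with \<open>t x\<close> through
  \<open>order_iff\<close>, at the parameters \<open>t\<close> and \<open>1 / t\<close>.\<close>

lemma scaleR_map:
  assumes "0 < t" "x \<in> pos_def_cone"
  shows "f (t *\<^sub>R x) = t *\<^sub>R f x"
proof (rule positive_eqI)
  have tx: "t *\<^sub>R x \<in> pos_def_cone" using assms by (rule cone_scaleR)
  have zero: "positive (0 :: 'c::unital_cstar_algebra)" using positive_of_real[of 0] by simp
  show "positive (t *\<^sub>R f x - f (t *\<^sub>R x))" using order_iff[OF tx assms(2)] zero by simp
  have "positive (inverse t *\<^sub>R f (t *\<^sub>R x) - f x)"
    using order_iff[OF assms(2) tx, of "inverse t"] assms zero by simp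
  then have "positive (t *\<^sub>R (inverse t *\<^sub>R f (t *\<^sub>R x) - f x))"
    using assms by (simp only: positive_scaleR_iff)
  then show "positive (f (t *\<^sub>R x) - t *\<^sub>R f x)" using assms by (simp add: scaleR_right_diff_distrib)
qed

text \<open>
  With \<open>x = s\<^sup>2\<close>, \<open>y = r\<^sup>2\<close> the two ways of writing \<open>f (s\<^sup>2 r\<^sup>2)\<close> say that \<open>f s f r\<close> is normal. It is
  similar to a positive element, so its spectrum is real and it is self-adjoint.
\<close>

lemma commute_map:
  assumes x: "x \<in> pos_def_cone" and y: "y \<in> pos_def_cone" and xy: "x * y = y * x"
  shows "f x * f y = f y * f x"
proof -
  obtain s where s: "s \<in> pos_def_cone" "s * s = x" "\<And>u. x * u = u * x \<Longrightarrow> s * u = u * s"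
    using cone_sqrt_exists[OF x] by metis
  obtain r where r: "r \<in> pos_def_cone" "r * r = y" "\<And>u. y * u = u * y \<Longrightarrow> r * u = u * r"
    using cone_sqrt_exists[OF y] by metis
  have sr: "s * r = r * s" using s(3) r(3) xy by metis
  define p q where "p = f s" and "q = f r"
  have pq: "p \<in> pos_def_cone" "q \<in> pos_def_cone" using s(1) r(1) by (simp_all add: p_def q_def in_cone)
  have "s * (r * r) * s = r * (s * s) * r" using sr by (metis mult.assoc)
  then have "f (s * (r * r) * s) = f (r * (s * s) * r)" by simp
  then have eq: "p * (q * q) * p = q * (p * p) * q"
    using s(1,2) r(1,2) x y triple[OF s(1), of y] triple[OF r(1), of x] square[OF s(1)] square[OF r(1)]
    by (simp add: p_def q_def)
  obtain c where c: "c \<in> pos_def_cone" "c * c = p" using cone_sqrt_exists[OF pq(1)] by metis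
  note inv = cone_invertible[OF c(1)]
  have star: "star (p * q) = q * p" using pq by (simp add: star_mult cone_selfadjoint)
  have "p * q = c * (c * q * c) * alg_inv c"
    using inv by (simp add: mult.assoc alg_inv_simps flip: c(2))
  then have "spectrum (p * q) = spectrum (c * q * c)" by (simp add: spectrum_similar[OF inv])
  also have "\<dots> \<subseteq> \<real>" using spectrum_selfadjoint cone_selfadjoint cone_congruence[OF c(1) pq(2)] by blast
  finally have "star (p * q) = p * q"
    using eq star by (intro normal_real_spectrum_selfadjoint) (simp_all add: mult.assoc)
  then have "p * q = q * p" using star by simp
  then have "(p * p) * (q * q) = (q * q) * (p * p)" by (metis mult.assoc)
  then show ?thesis using square[OF s(1)] square[OF r(1)] s(2) r(2) by (simp add: p_def q_def)
qed

text \<open>As functions of \<open>x\<close> the majorants \<open>z\<close> are parabolas with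
  minimum \<open>1 + e\<close> at \<open>\<alpha>\<close>, so an element that commutes with
  \<open>x\<close> and lies below all of them is at most \<open>1 + e\<close>.\<close>

lemma subadditive_at_one:
  assumes x: "x \<in> pos_def_cone" and y: "y \<in> pos_def_cone" and xy: "x + y = 1"
  shows "positive (1 - (f x + f y))"
proof -
  define g where "g = inv_into pos_def_cone f"
  interpret g: unital_gauge_isometry g unfolding g_def by (rule inverse_isometry)
  define w where "w = g (f x + f y)"
  have sum: "f x + f y \<in> pos_def_cone" using x y by (intro cone_add(1) in_cone cone_positive)
  have w: "w \<in> pos_def_cone" "f w = f x + f y"
    using sum by (simp_all add: w_def g.in_cone) (simp add: g_def inverse_isometry)
  have gx: "g (f x) = x" using x by (simp add: g_def inverse_isometry)
  have y_eq: "y = 1 - x" using xy by (simp add: algebra_simps)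
  \<comment> \<open>Commutativity is carried to the images and, through \<open>g\<close>, back
    again, so that \<open>w\<close> commutes with \<open>x\<close>.\<close>
  have "f x * f y = f y * f x" using x y by (intro commute_map) (simp_all add: y_eq algebra_simps)
  then have "g (f x) * w = w * g (f x)"
    unfolding w_def using x sum by (intro g.commute_map in_cone) (simp_all add: algebra_simps)
  then have wx: "x * w = w * x" by (simp add: gx)
  obtain d1 d2 where d: "d1 > 0" "positive (x - of_real d1)" "d2 > 0" "positive (y - of_real d2)"
    using x y by (auto simp: cone_iff)
  \<comment> \<open>A margin below the spectra of \<open>x\<close> and \<open>y = 1 - x\<close>. The
    element \<open>U\<close> rescales the interval from \<open>m\<close> to \<open>1 - m\<close>, of
    length \<open>l\<close>, to the unit interval.\<close>
  define m where "m = min (min d1 d2) (1/2) / 2"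
  have m: "0 < m" "m < d1" "m < d2" "m < 1/2" using d by (auto simp: m_def)
  define l where "l = 1 - 2 * m"
  have l: "l > 0" using m by (simp add: l_def)
  have shift: "u - of_real m \<in> pos_def_cone" if "positive (u - of_real e)" "m < e" for u :: 'a and e
    using cone_add(2)[OF cone_of_real that(1), of "e - m"] that(2) by simp
  define U where "U = (1 / l) *\<^sub>R (x - of_real m)"
  have U: "U \<in> pos_def_cone" using shift[OF d(2)] m l by (simp add: U_def cone_scaleR)
  have "1 - U = (1 / l) *\<^sub>R (y - of_real m)"
  proof -
    have "y - of_real m = l *\<^sub>R 1 - (x - of_real m)"
      by (simp add: y_eq l_def of_real_def algebra_simps flip: scaleR_left_distrib)
    then show ?thesis using l by (simp add: U_def scaleR_right_diff_distrib del: scaleR_left_diff_distrib)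
  qed
  then have U': "1 - U \<in> pos_def_cone" using shift[OF d(4)] m l by (simp add: cone_scaleR)
  have "positive (1 - w)"
  proof (rule positive_closed)
    fix e :: real assume e: "0 < e"
    define N where "N = 1 / (4 * e * m\<^sup>2)"
    have N: "N > 0" using e m by (simp add: N_def)
    have "positive (- (w - of_real (1 + e)))"
    proof (rule nonpositive_if_below_parabolas[OF U U', where N = "N * l\<^sup>2"])
      show "U * (w - of_real (1 + e)) = (w - of_real (1 + e)) * U"
        using wx by (simp add: U_def of_real_def algebra_simps)
      show "0 \<le> N * l\<^sup>2" using N by simp
      fix b :: real assume b: "0 \<le> b" "b \<le> 1"
      define \<alpha> where "\<alpha> = m + l * b"
      have "0 \<le> l * b" "l * b \<le> l" using l b by (auto simp: mult_left_le)
      then have \<alpha>: "m \<le> \<alpha>" "m \<le> 1 - \<alpha>" by (auto simp: \<alpha>_def l_def)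
      define z where "z = of_real (1 + e) + N *\<^sub>R ((x - of_real \<alpha>) * (x - of_real \<alpha>))"
      have z: "z \<in> pos_def_cone"
        unfolding z_def using e N x
        by (intro cone_add(1) cone_of_real positive_scaleR positive_square)
          (auto simp: star_diff cone_selfadjoint)
      have "positive (\<alpha> *\<^sub>R z - x)"
        unfolding z_def N_def using x m \<alpha> e by (intro quadratic_majorant) (auto simp: cone_selfadjoint)
      then have 1: "positive (\<alpha> *\<^sub>R f z - f x)" using x z by (simp add: order_iff)
      \<comment> \<open>The same \<open>z\<close> is the parabola of \<open>y\<close> at the node
        \<open>1 - \<alpha>\<close>, so both majorizations use one \<open>z\<close> and their images
        add up to \<open>f x + f y \<le> f z\<close>.\<close>
      have "y - of_real (1 - \<alpha>) = - (x - of_real \<alpha>)" by (simp add: y_eq)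
      then have "z = of_real (1 + e) + N *\<^sub>R ((y - of_real (1 - \<alpha>)) * (y - of_real (1 - \<alpha>)))"
        by (simp only: z_def minus_mult_minus)
      then have "positive ((1 - \<alpha>) *\<^sub>R z - y)"
        using y m \<alpha> e by (simp only: N_def) (intro quadratic_majorant; simp add: cone_selfadjoint)
      then have 2: "positive ((1 - \<alpha>) *\<^sub>R f z - f y)" using y z by (simp add: order_iff)
      have "positive (f z - f w)"
        using positive_add[OF 1 2] by (simp add: w algebra_simps)
      then have "positive (z - w)" using mono_iff[OF w(1) z] by blast
      moreover have "x - of_real \<alpha> = l *\<^sub>R (U - of_real b)"
        using l by (simp add: U_def \<alpha>_def of_real_def algebra_simps)
      then have "z - w = (N * l\<^sup>2) *\<^sub>R ((U - of_real b) * (U - of_real b)) - (w - of_real (1 + e))"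
        by (simp add: z_def power2_eq_square mult_ac)
      ultimately show "positive ((N * l\<^sup>2) *\<^sub>R ((U - of_real b) * (U - of_real b)) - (w - of_real (1 + e)))"
        by simp
    qed
    then show "positive (of_real e + (1 - w))" by (simp add: algebra_simps)
  qed
  then show ?thesis using mono_iff[OF w(1) cone_one] by (simp add: one w)
qed

text \<open>The element \<open>q = 1 - f x\<close> dominates \<open>f y\<close>. Subadditivity of
  the inverse map, applied to \<open>f x + q = 1\<close>, gives \<open>g q \<le> y\<close> and hence
  \<open>q \<le> f y\<close>.\<close>

lemma additive_at_one:
  assumes x: "x \<in> pos_def_cone" and y: "y \<in> pos_def_cone" and xy: "x + y = 1"
  shows "f x + f y = 1"
proof -
  define g where "g = inv_into pos_def_cone f"
  interpret g: unital_gauge_isometry g unfolding g_def by (rule inverse_isometry)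
  define q where "q = 1 - f x"
  have le: "positive (q - f y)"
    using subadditive_at_one[OF assms] by (simp add: q_def algebra_simps)
  have "f y + (q - f y) \<in> pos_def_cone" using le y by (intro cone_add(1) in_cone)
  then have q: "q \<in> pos_def_cone" by simp
  have gq: "g q \<in> pos_def_cone" "f (g q) = q" using q by (simp add: g.in_cone) (simp add: q g_def inverse_isometry)
  have "positive (1 - (g (f x) + g q))"
    using x q by (intro g.subadditive_at_one in_cone) (auto simp: q_def)
  then have "positive (y - g q)" using x xy by (simp add: g_def inverse_isometry algebra_simps)
    (metis add_diff_cancel_left' diff_diff_eq)
  then have "positive (f y - q)" using mono_iff[OF gq(1) y] gq by simp
  then have "q = f y" using le by (intro positive_eqI)
  then show ?thesis by (simp add: q_def algebra_simps)
qed

text \<open>Congruence by the inverse root of \<open>a + b\<close> turns the pair into one with sum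
  1, and by \<open>triple\<close> the map \<open>f\<close> follows the congruence back.\<close>

lemma additive:
  assumes a: "a \<in> pos_def_cone" and b: "b \<in> pos_def_cone"
  shows "f (a + b) = f a + f b"
proof -
  have "a + b \<in> pos_def_cone" using a b by (intro cone_add(1) cone_positive)
  then obtain s where s: "s \<in> pos_def_cone" "s * s = a + b" using cone_sqrt_exists by metis
  note inv = cone_invertible[OF s(1)]
  define x y where "x = alg_inv s * a * alg_inv s" and "y = alg_inv s * b * alg_inv s"
  have xy: "x \<in> pos_def_cone" "y \<in> pos_def_cone"
    using a b s by (simp_all add: x_def y_def cone_congruence cone_alg_inv)
  have "x + y = alg_inv s * (s * s) * alg_inv s"
    by (simp add: x_def y_def s(2) algebra_simps)
  then have "f x + f y = 1" using inv xy by (intro additive_at_one) (simp_all add: mult.assoc alg_inv_simps)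
  moreover have "a = s * x * s" "b = s * y * s"
    using inv by (simp_all add: x_def y_def mult.assoc alg_inv_simps)
  then have "f a + f b = f s * (f x + f y) * f s"
    using triple[OF s(1)] xy by (simp add: algebra_simps)
  ultimately show ?thesis using square[OF s(1)] s(2) by simp
qed

end

section \<open>Jordan isomorphisms\<close>

definition real_part :: "'a::unital_cstar_algebra \<Rightarrow> 'a" where
  "real_part a = (1/2) *\<^sub>C (a + star a)"

definition imag_part :: "'a::unital_cstar_algebra \<Rightarrow> 'a" where
  "imag_part a = (- \<i> / 2) *\<^sub>C (a - star a)"

lemma cartesian_decomposition:
  fixes a :: "'a::unital_cstar_algebra"
  obtains h k where "star h = h" "star k = k" "a = h + \<i> *\<^sub>C k"
proof
  show "star (real_part a) = real_part a" "star (imag_part a) = imag_part a"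
    by (simp_all add: real_part_def imag_part_def star_scaleC star_add star_diff star_star
        scaleC_simps add.commute)
  have "real_part a + \<i> *\<^sub>C imag_part a = (1/2 + 1/2) *\<^sub>C a"
    unfolding scaleC_add_left by (simp add: real_part_def imag_part_def scaleC_simps scaleC_scaleC)
  then show "a = real_part a + \<i> *\<^sub>C imag_part a" by simp
qed

lemma parts_cartesian:
  fixes h k :: "'a::unital_cstar_algebra"
  assumes "star h = h" "star k = k"
  shows "real_part (h + \<i> *\<^sub>C k) = h" "imag_part (h + \<i> *\<^sub>C k) = k"
proof -
  have s: "star (h + \<i> *\<^sub>C k) = h - \<i> *\<^sub>C k" using assms by (simp add: star_add star_scaleC)
  have "real_part (h + \<i> *\<^sub>C k) = (1/2 + 1/2) *\<^sub>C h"
    unfolding scaleC_add_left real_part_def s by (simp add: scaleC_simps)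
  then show "real_part (h + \<i> *\<^sub>C k) = h" by simp
  have "imag_part (h + \<i> *\<^sub>C k) = (1/2 + 1/2) *\<^sub>C k"
    unfolding scaleC_add_left imag_part_def s by (simp add: scaleC_simps scaleC_scaleC)
  then show "imag_part (h + \<i> *\<^sub>C k) = k" by simp
qed

lemma jordan_product_self: "jordan_product a a = a * (a::'a::unital_cstar_algebra)"
proof -
  have "jordan_product a a = (1/2 + 1/2) *\<^sub>C (a * a)"
    unfolding scaleC_add_left jordan_product_def by (simp add: scaleC_simps)
  then show ?thesis by simp
qed

lemma jordan_product_polarization:
  "jordan_product a b = (1/2) *\<^sub>C ((a + b) * (a + b) - a * a - b * (b::'a::unital_cstar_algebra))"
  by (simp add: jordan_product_def algebra_simps)

section \<open>Jordan isomorphisms, triple products and invertibility\<close>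

locale jordan_star_iso =
  fixes J :: "'a::unital_cstar_algebra \<Rightarrow> 'b::unital_cstar_algebra"
  assumes iso: "jordan_star_isomorphism J"
begin

lemma linear: "J (a + b) = J a + J b" "J (c *\<^sub>C a) = c *\<^sub>C J a" "J (a - b) = J a - J b"
proof -
  show *: "J (a + b) = J a + J b" "J (c *\<^sub>C a) = c *\<^sub>C J a" for a b c
    using iso by (auto simp: jordan_star_isomorphism_def)
  show "J (a - b) = J a - J b" using *(1)[of "a - b" b] by simp
qed

lemma jordan: "J (a * b + b * a) = J a * J b + J b * J a"
proof -
  have "J (2 *\<^sub>C jordan_product a b) = 2 *\<^sub>C jordan_product (J a) (J b)"
    using iso linear(2) by (auto simp: jordan_star_isomorphism_def)
  then show ?thesis by (simp only: jordan_product_def scaleC_scaleC) simp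
qed

text \<open>For the preimage \<open>u\<close> of 1, the Jordan product of \<open>u\<close> and 1 is
  \<open>u\<close>; applying \<open>J\<close> shows that the Jordan product of 1 and
  \<open>J 1\<close> is 1.\<close>

lemma one: "J 1 = 1"
proof -
  obtain u where u: "J u = 1" using iso by (metis bij_pointE jordan_star_isomorphism_def)
  have "jordan_product u 1 = u" using jordan_product_polarization[of u 1]
    by (simp add: jordan_product_def scaleC_simps flip: scaleC_add_left)
  then have "jordan_product (J u) (J 1) = J u"
    using iso by (metis jordan_star_isomorphism_def)
  then show ?thesis by (simp add: u jordan_product_def scaleC_simps flip: scaleC_add_left)
qed

text \<open>\<open>2 a b a = a (a b + b a) + (a b + b a) a - (a^2 b + b a^2)\<close>, which involves
  Jordan products only.\<close>

lemma triple: "J (a * b * a) = J a * J b * J a"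
proof -
  have sq: "J (a * a) = J a * J a"
    using iso jordan_product_self by (metis jordan_star_isomorphism_def)
  have id: "2 *\<^sub>C (x * y * x) = (x * (x * y + y * x) + (x * y + y * x) * x) - (x * x * y + y * (x * x))"
    for x y :: "'c::unital_cstar_algebra"
  proof -
    have "2 *\<^sub>C (x * y * x) = x * y * x + x * y * x"
      using scaleC_add_left[of 1 1 "x * y * x"] by simp
    then show ?thesis by (simp add: algebra_simps)
  qed
  have "2 *\<^sub>C J (a * b * a) = J (2 *\<^sub>C (a * b * a))" by (simp add: linear)
  also have "\<dots> = 2 *\<^sub>C (J a * J b * J a)"
    unfolding id by (simp only: linear(3) jordan sq linear(1)[of "a * (a * b + b * a)"])
  finally show ?thesis by (simp add: scaleC.scale_left_imp_eq)
qed

lemma invertible_iff: "is_invertible (J a) \<longleftrightarrow> is_invertible a"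
proof
  assume a: "is_invertible a"
  define b where "b = alg_inv a * alg_inv a"
  have "a * b * a = 1" using a by (simp add: b_def mult.assoc alg_inv_simps)
  then have "J a * J b * J a = 1" using triple one by metis
  then show "is_invertible (J a)" by (metis is_invertibleI mult.assoc)
next
  assume a: "is_invertible (J a)"
  obtain b where b: "J b = alg_inv (J a) * alg_inv (J a)"
    using iso by (metis bij_pointE jordan_star_isomorphism_def)
  have "J (a * b * a) = J 1" unfolding triple b one using a by (simp add: mult.assoc alg_inv_simps)
  then have "a * b * a = 1" using iso by (meson bij_def injD jordan_star_isomorphism_def)
  then show "is_invertible a" by (metis is_invertibleI mult.assoc)
qed

end

section \<open>Extension of a unital gauge isometry to the whole algebra\<close>

context unital_gauge_isometry
begin

text \<open>The scalar \<open>norm h + 1\<close> is one shift that moves a self-adjoint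
  \<open>h\<close> into the cone. Since \<open>f\<close> commutes with adding positive scalars,
  every such shift gives the same value (\<open>sa_extension_eq\<close>).\<close>

definition sa_extension :: "'a \<Rightarrow> 'b" where
  "sa_extension h = f (h + of_real (norm h + 1)) - of_real (norm h + 1)"

lemma shift_map:
  assumes "x \<in> pos_def_cone" "0 < t"
  shows "f (x + of_real t) = f x + of_real t"
  using additive[OF assms(1) cone_of_real[OF assms(2)]] scaleR_map[OF assms(2) cone_one]
  by (simp add: one of_real_def)

lemma sa_extension_eq:
  assumes h: "star h = h" and t: "h + of_real t \<in> pos_def_cone"
  shows "sa_extension h = f (h + of_real t) - of_real t"
proof -
  have *: "f (h + of_real s) - of_real s = f (h + of_real t) - of_real t"
    if "h + of_real t \<in> pos_def_cone" "t < s" for s t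
    using shift_map[OF that(1), of "s - t"] that(2) by simp
  have u: "h + of_real (norm h + 1) \<in> pos_def_cone" using h by (intro cone_shift(1)) auto
  show ?thesis unfolding sa_extension_def
    using *[OF u, of t] *[OF t, of "norm h + 1"] by (metis linorder_neqE_linordered_idom)
qed

lemma sa_extension_cone: "x \<in> pos_def_cone \<Longrightarrow> sa_extension x = f x"
  using sa_extension_eq[of x 0] by (simp add: cone_selfadjoint)

lemma sa_shift:
  assumes "star h = (h::'a)"
  obtains t where "0 < t" "h + of_real t \<in> pos_def_cone"
  using cone_shift(1)[OF assms, of "norm h + 1"] that[of "norm h + 1"] by (simp add: add_nonneg_pos)

lemma sa_extension_star:
  assumes "star h = h"
  shows "star (sa_extension h) = sa_extension h"
proof -
  obtain t where "0 < t" "h + of_real t \<in> pos_def_cone" using sa_shift[OF assms] .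
  then show ?thesis using assms
    by (simp add: sa_extension_eq star_diff cone_selfadjoint in_cone)
qed

lemma sa_extension_add:
  assumes h: "star h = h" and k: "star k = k"
  shows "sa_extension (h + k) = sa_extension h + sa_extension k"
proof -
  obtain t s where t: "h + of_real t \<in> pos_def_cone" and s: "k + of_real s \<in> pos_def_cone"
    using sa_shift h k by metis
  have eq: "(h + k) + of_real (t + s) = (h + of_real t) + (k + of_real s)" by simp
  have "(h + k) + of_real (t + s) \<in> pos_def_cone"
    unfolding eq using t cone_positive[OF s] by (rule cone_add(1))
  then have "sa_extension (h + k) = f ((h + k) + of_real (t + s)) - of_real (t + s)"
    using h k by (intro sa_extension_eq) (auto simp: star_add)
  also have "\<dots> = f (h + of_real t) + f (k + of_real s) - of_real (t + s)"
    unfolding eq additive[OF t s] ..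
  finally show ?thesis using t s h k by (simp add: sa_extension_eq)
qed

lemma sa_extension_zero: "sa_extension 0 = 0"
  using sa_extension_add[of 0 0] by simp

lemma sa_extension_minus:
  assumes "star h = h"
  shows "sa_extension (- h) = - sa_extension h"
  using sa_extension_add[of h "- h"] assms sa_extension_zero by (simp add: minus_unique)

lemma sa_extension_scaleR:
  assumes h: "star h = h"
  shows "sa_extension (r *\<^sub>R h) = r *\<^sub>R sa_extension h"
proof -
  have pos: "sa_extension (r *\<^sub>R h) = r *\<^sub>R sa_extension h" if r: "r > 0" for r
  proof -
    obtain t where t: "h + of_real t \<in> pos_def_cone" using sa_shift[OF h] .
    have eq: "r *\<^sub>R h + of_real (r * t) = r *\<^sub>R (h + of_real t)"
      by (simp add: of_real_def scaleR_add_right)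
    have "r *\<^sub>R h + of_real (r * t) \<in> pos_def_cone"
      unfolding eq using r t by (rule cone_scaleR)
    then have "sa_extension (r *\<^sub>R h) = f (r *\<^sub>R h + of_real (r * t)) - of_real (r * t)"
      using h by (intro sa_extension_eq) (auto simp: star_scaleR)
    also have "\<dots> = r *\<^sub>R sa_extension h"
      unfolding eq scaleR_map[OF r t] sa_extension_eq[OF h t]
      by (simp add: of_real_def scaleR_right_diff_distrib)
    finally show ?thesis .
  qed
  consider "r > 0" | "r = 0" | "- r > 0" by linarith
  then show ?thesis
  proof cases
    case 3
    then show ?thesis using pos[of "- r"] sa_extension_minus[of "r *\<^sub>R h"] h
      by (simp add: star_scaleR)
  qed (auto simp: pos sa_extension_zero)
qed

text \<open>Expand the square of \<open>h + t\<close> before and after applying \<open>f\<close>,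
  and cancel the linear and scalar terms.\<close>

lemma sa_extension_square:
  assumes h: "star h = h"
  shows "sa_extension (h * h) = sa_extension h * sa_extension h"
proof -
  obtain t where t: "0 < t" "h + of_real t \<in> pos_def_cone" using sa_shift[OF h] .
  define E where "E = sa_extension h"
  have fE: "f (h + of_real t) = E + of_real t" using sa_extension_eq[OF h t(2)] by (simp add: E_def)
  have eq: "(h + of_real t) * (h + of_real t) = h * h + ((2 * t) *\<^sub>R h + of_real (t * t))"
    by (simp add: of_real_def algebra_simps flip: scaleR_left_distrib)
  have scalar: "sa_extension (of_real (t * t)) = of_real (t * t)"
    unfolding sa_extension_cone[OF cone_of_real[OF mult_pos_pos[OF t(1) t(1)]]]
    using scaleR_map[OF mult_pos_pos[OF t(1) t(1)] cone_one] by (simp add: one of_real_def)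
  have "(h + of_real t) * (h + of_real t) \<in> pos_def_cone"
    using cone_congruence[OF t(2) cone_one] by simp
  then have "f ((h + of_real t) * (h + of_real t)) = sa_extension (h * h + ((2 * t) *\<^sub>R h + of_real (t * t)))"
    by (simp only: sa_extension_cone flip: eq)
  also have "\<dots> = sa_extension (h * h) + ((2 * t) *\<^sub>R E + of_real (t * t))"
    using h scalar by (simp add: sa_extension_add sa_extension_scaleR star_simps E_def del: of_real_mult)
  finally have "sa_extension (h * h) + ((2 * t) *\<^sub>R E + of_real (t * t)) = (E + of_real t) * (E + of_real t)"
    using square[OF t(2)] fE by simp
  also have "\<dots> = E * E + ((2 * t) *\<^sub>R E + of_real (t * t))"
    by (simp add: of_real_def algebra_simps flip: scaleR_left_distrib)
  finally show ?thesis by (simp add: E_def)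
qed

lemma sa_extension_inj:
  assumes h: "star h = h" and zero: "sa_extension h = 0"
  shows "h = 0"
proof -
  obtain t where t: "0 < t" "h + of_real t \<in> pos_def_cone" using sa_shift[OF h] .
  have "f (h + of_real t) = f (of_real t)"
    using sa_extension_eq[OF h t(2)] zero scaleR_map[OF t(1) cone_one] by (simp add: one of_real_def)
  then have "h + of_real t = of_real t"
    using bij t cone_of_real[OF t(1)] by (metis bij_betw_def inj_onD)
  then show ?thesis by simp
qed

lemma sa_extension_surj:
  assumes k: "star k = k"
  obtains h where "star h = h" "sa_extension h = k"
proof -
  have "k + of_real (norm k + 1) \<in> pos_def_cone" using k by (intro cone_shift(1)) auto
  then obtain x where x: "x \<in> pos_def_cone" "k + of_real (norm k + 1) = f x" using surj_cone by metis
  define t where "t = norm k + 1"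
  have "star (x - of_real t) = x - of_real t" using x by (simp add: star_diff cone_selfadjoint)
  moreover have "sa_extension (x - of_real t) = k"
    using sa_extension_eq[OF calculation, of t] x by (simp add: t_def flip: x(2))
  ultimately show thesis by (rule that)
qed

definition extension :: "'a \<Rightarrow> 'b" where
  "extension a = sa_extension (real_part a) + \<i> *\<^sub>C sa_extension (imag_part a)"

lemma extension_cartesian:
  assumes "star h = h" "star k = k"
  shows "extension (h + \<i> *\<^sub>C k) = sa_extension h + \<i> *\<^sub>C sa_extension k"
  using assms by (simp add: extension_def parts_cartesian)

lemma extension_cone:
  assumes "x \<in> pos_def_cone"
  shows "extension x = f x"
  using extension_cartesian[of x 0] assms
  by (simp add: cone_selfadjoint sa_extension_cone sa_extension_zero)

lemma extension_add: "extension (a + b) = extension a + extension b"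
proof -
  obtain h k where a: "star h = h" "star k = k" "a = h + \<i> *\<^sub>C k" by (rule cartesian_decomposition)
  obtain h' k' where b: "star h' = h'" "star k' = k'" "b = h' + \<i> *\<^sub>C k'" by (rule cartesian_decomposition)
  have sum: "a + b = (h + h') + \<i> *\<^sub>C (k + k')" by (simp add: a(3) b(3) scaleC_add_right)
  have "extension (a + b) = sa_extension (h + h') + \<i> *\<^sub>C sa_extension (k + k')"
    unfolding sum using a(1,2) b(1,2) by (intro extension_cartesian) (simp_all add: star_add)
  then show ?thesis using a(1,2) b(1,2) unfolding a(3) b(3)
    by (simp add: extension_cartesian sa_extension_add scaleC_add_right)
qed

lemma extension_scaleC: "extension (c *\<^sub>C a) = c *\<^sub>C extension a"
proof -
  obtain h k where a: "star h = h" "star k = k" "a = h + \<i> *\<^sub>C k" by (rule cartesian_decomposition)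
  define p q where "p = Re c" and "q = Im c"
  have c: "c = of_real p + \<i> * of_real q" by (simp add: p_def q_def complex_eq)
  have mult: "c *\<^sub>C (x + \<i> *\<^sub>C y) = (p *\<^sub>R x - q *\<^sub>R y) + \<i> *\<^sub>C (q *\<^sub>R x + p *\<^sub>R y)"
    for x y :: "'c::unital_cstar_algebra"
    unfolding c by (simp add: scaleC_simps scaleC_scaleC algebra_simps flip: scaleC_of_real)
  have diff: "sa_extension (p *\<^sub>R h - q *\<^sub>R k) = p *\<^sub>R sa_extension h - q *\<^sub>R sa_extension k"
    using sa_extension_add[of "p *\<^sub>R h" "- (q *\<^sub>R k)"] a
    by (simp add: star_scaleR sa_extension_scaleR sa_extension_minus)
  show ?thesis
    unfolding a(3) mult extension_cartesian[OF a(1,2)] using a(1,2)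
    by (simp add: extension_cartesian star_simps diff sa_extension_add sa_extension_scaleR)
qed

text \<open>The image of the self-adjoint cross term \<open>h k + k h\<close> is found by comparing
  the squares of \<open>h\<close>, \<open>k\<close> and \<open>h + k\<close>.\<close>

lemma extension_square: "extension (a * a) = extension a * extension a"
proof -
  obtain h k where a: "star h = h" "star k = k" "a = h + \<i> *\<^sub>C k" by (rule cartesian_decomposition)
  have sq: "(x + \<i> *\<^sub>C y) * (x + \<i> *\<^sub>C y) = (x * x + - (y * y)) + \<i> *\<^sub>C (x * y + y * x)"
    for x y :: "'c::unital_cstar_algebra"
    by (simp add: algebra_simps scaleC_simps scaleC_scaleC)
  define p q where "p = sa_extension h" and "q = sa_extension k"
  have "(h + k) * (h + k) = h * h + (k * k + (h * k + k * h))" by (simp add: algebra_simps)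
  moreover have "sa_extension ((h + k) * (h + k)) = (p + q) * (p + q)"
    using a(1,2) by (simp only: sa_extension_square sa_extension_add star_add p_def q_def)
  moreover have "sa_extension (h * h + (k * k + (h * k + k * h))) = p * p + (q * q + sa_extension (h * k + k * h))"
    using a(1,2)
    by (simp add: sa_extension_square sa_extension_add star_simps add.commute p_def q_def)
  ultimately have "p * p + (q * q + sa_extension (h * k + k * h)) = (p + q) * (p + q)" by simp
  then have "sa_extension (h * k + k * h) = sa_extension h * sa_extension k + sa_extension k * sa_extension h"
    by (simp add: p_def q_def algebra_simps)
  moreover have "sa_extension (h * h - k * k) = sa_extension h * sa_extension h - sa_extension k * sa_extension k"
    using sa_extension_add[of "h * h" "- (k * k)"] a(1,2)
    by (simp add: star_simps sa_extension_minus sa_extension_square)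
  ultimately show ?thesis
    unfolding a(3) extension_cartesian[OF a(1,2)] sq using a(1,2)
    by (simp add: extension_cartesian star_simps add.commute)
qed

lemma extension_star: "extension (star a) = star (extension a)"
proof -
  obtain h k where a: "star h = h" "star k = k" "a = h + \<i> *\<^sub>C k" by (rule cartesian_decomposition)
  have "star a = h + \<i> *\<^sub>C (- k)" using a by (simp add: star_add star_scaleC)
  then have "extension (star a) = sa_extension h + \<i> *\<^sub>C sa_extension (- k)"
    using a by (simp only: extension_cartesian star_minus)
  then show ?thesis using a(1,2) unfolding a(3)
    by (simp add: extension_cartesian sa_extension_minus star_add star_scaleC sa_extension_star)
qed

lemma extension_bij: "bij extension"
proof (rule bijI)
  have zero: "a = 0" if "extension a = 0" for a
  proof -
    obtain h k where a: "star h = h" "star k = k" "a = h + \<i> *\<^sub>C k" by (rule cartesian_decomposition)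
    have "sa_extension h + \<i> *\<^sub>C sa_extension k = 0 + \<i> *\<^sub>C 0"
      using that a by (simp add: extension_cartesian)
    then have "sa_extension h = 0" "sa_extension k = 0"
      using parts_cartesian[of "sa_extension h" "sa_extension k"] parts_cartesian[of "0::'b" 0] a
      by (simp_all add: sa_extension_star)
    then have "h = 0" "k = 0" using a sa_extension_inj by blast+
    then show "a = 0" by (simp add: a(3))
  qed
  show "inj extension"
  proof (rule injI)
    fix a b assume "extension a = extension b"
    then have "extension (a - b) = 0" using extension_add[of "a - b" b] by simp
    then show "a = b" using zero by fastforce
  qed
  show "surj extension"
    unfolding surj_def
  proof
    fix b :: 'b
    obtain h k where b: "star h = h" "star k = k" "b = h + \<i> *\<^sub>C k" by (rule cartesian_decomposition)
    obtain h' k' where "star h' = h'" "sa_extension h' = h" "star k' = k'" "sa_extension k' = k"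
      using sa_extension_surj b(1,2) by metis
    then show "\<exists>a. b = extension a" using b(3) extension_cartesian by metis
  qed
qed

lemma extension_jordan_star_isomorphism: "jordan_star_isomorphism extension"
proof -
  have "extension (- a) = - extension a" for a
    using extension_scaleC[of "-1" a] by simp
  then have diff: "extension (a - b) = extension a - extension b" for a b
    using extension_add[of a "- b"] by simp
  show ?thesis
    unfolding jordan_star_isomorphism_def
    by (simp add: extension_bij extension_add extension_scaleC extension_star diff extension_square
        jordan_product_polarization)
qed

end

text \<open>\<open>t \<phi> y - \<phi> x\<close> is the congruence by \<open>c\<close> of
  \<open>J (t y - x)\<close>, so both pencils are singular at the same \<open>t\<close>. The factor
  \<open>c\<close> is invertible because \<open>c * c = \<phi> 1\<close> lies in the cone.\<close>

lemma spectrum_jordan_congruence: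
  fixes \<phi> :: "'a::unital_cstar_algebra \<Rightarrow> 'b::unital_cstar_algebra"
  assumes surj: "\<phi> ` pos_def_cone = pos_def_cone" and J: "jordan_star_isomorphism J"
    and \<phi>: "\<And>x. x \<in> pos_def_cone \<Longrightarrow> \<phi> x = c * J x * c"
    and x: "x \<in> pos_def_cone" and y: "y \<in> pos_def_cone"
  shows "spectrum (\<phi> x * alg_inv (\<phi> y)) = spectrum (x * alg_inv y)"
proof -
  interpret jordan_star_iso J by unfold_locales (rule J)
  have inv: "is_invertible (\<phi> u)" if "u \<in> pos_def_cone" for u
    using surj that by (blast intro: cone_invertible)
  have "is_invertible (c * c)" using inv[OF cone_one] \<phi>[OF cone_one] by (simp add: one)
  then have c: "is_invertible c" by (rule is_invertible_commuting_square)
  have "t *\<^sub>C \<phi> y - \<phi> x = c * J (t *\<^sub>C y - x) * c" for t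
    by (simp add: \<phi> x y linear algebra_simps scaleC_simps)
  then show ?thesis
    by (simp add: spectrum_mult_alg_inv inv cone_invertible y is_invertible_congruence[OF c c] invertible_iff)
qed

text \<open>Congruence by the inverse root of \<open>\<phi> 1\<close> preserves the gauge and
  normalizes \<open>\<phi>\<close> to a unital isometry, whose extension is \<open>J\<close>.
  Injectivity of \<open>\<phi>\<close> holds because equal images force both gauge ratios to be
  1.\<close>

lemma gauge_isometry_jordan:
  fixes \<phi> :: "'a::unital_cstar_algebra \<Rightarrow> 'b::unital_cstar_algebra"
  assumes surj: "\<phi> ` pos_def_cone = pos_def_cone"
    and gauge: "\<And>x y. x \<in> pos_def_cone \<Longrightarrow> y \<in> pos_def_cone \<Longrightarrow> gauge_ratio (\<phi> x) (\<phi> y) = gauge_ratio x y"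
  obtains J where "jordan_star_isomorphism J"
    "\<And>x. x \<in> pos_def_cone \<Longrightarrow> \<phi> x = pos_sqrt (\<phi> 1) * J x * pos_sqrt (\<phi> 1)"
proof -
  have \<phi>P: "\<phi> x \<in> pos_def_cone" if "x \<in> pos_def_cone" for x using surj that by blast
  define c where "c = pos_sqrt (\<phi> 1)"
  define b where "b = alg_inv c"
  have c: "c \<in> pos_def_cone" "c * c = \<phi> 1"
    using pos_sqrt_cone(1,2)[OF \<phi>P[OF cone_one]] by (simp_all add: c_def)
  have b: "b \<in> pos_def_cone" using c by (simp add: b_def cone_alg_inv)
  note inv = cone_invertible[OF c(1)]
  have cb: "c * (b * u * b) * c = u" "b * (c * u * c) * b = u" for u
    using inv by (simp_all add: b_def mult.assoc alg_inv_simps)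
  have inj: "inj_on \<phi> pos_def_cone"
  proof (rule inj_onI)
    fix x y assume xy: "x \<in> pos_def_cone" "y \<in> pos_def_cone" "\<phi> x = \<phi> y"
    then have "gauge_ratio x y = 1" "gauge_ratio y x = 1"
      using gauge[of x y] gauge[of y x] gauge_ratio_self[OF \<phi>P[OF xy(1)]] by simp_all
    then show "x = y" using xy by (intro gauge_ratio_antisym) auto
  qed
  define f where "f x = b * \<phi> x * b" for x
  interpret unital_gauge_isometry f
  proof
    have "bij_betw (\<lambda>u. b * u * b) pos_def_cone pos_def_cone"
      by (rule bij_betw_byWitness[where f' = "\<lambda>u. c * u * c"])
        (use b c in \<open>auto simp: cb cone_congruence\<close>)
    then have "bij_betw ((\<lambda>u. b * u * b) \<circ> \<phi>) pos_def_cone pos_def_cone"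
      using inj surj by (intro bij_betw_trans) (auto simp: bij_betw_def)
    then show "bij_betw f pos_def_cone pos_def_cone" by (simp add: f_def[abs_def] comp_def)
    show "gauge_ratio (f x) (f y) = gauge_ratio x y" if "x \<in> pos_def_cone" "y \<in> pos_def_cone" for x y
      using that b by (simp add: f_def gauge_ratio_congruence cone_invertible \<phi>P gauge)
    show "f 1 = 1" using cb(2)[of 1] c by (simp add: f_def)
  qed
  show thesis
  proof (rule that[OF extension_jordan_star_isomorphism])
    show "\<phi> x = pos_sqrt (\<phi> 1) * extension x * pos_sqrt (\<phi> 1)" if "x \<in> pos_def_cone" for x
      using cb(1)[of "\<phi> x"] that by (simp add: extension_cone f_def c_def)
  qed
qed

theorem theorem2p4:
  fixes \<phi> :: "'a::unital_cstar_algebra \<Rightarrow> 'b::unital_cstar_algebra"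
  assumes surj: "\<phi> ` pos_def_cone = pos_def_cone"
  shows "((\<exists>J. jordan_star_isomorphism J \<and>
             (\<forall>x\<in>pos_def_cone. \<phi> x = pos_sqrt (\<phi> 1) * J x * pos_sqrt (\<phi> 1)))
          \<longleftrightarrow>
          (\<forall>x\<in>pos_def_cone. \<forall>y\<in>pos_def_cone.
             spectral_seminorm (\<phi> x * alg_inv (\<phi> y)) = spectral_seminorm (x * alg_inv y)))
       \<and> ((\<forall>x\<in>pos_def_cone. \<forall>y\<in>pos_def_cone.
             spectral_seminorm (\<phi> x * alg_inv (\<phi> y)) = spectral_seminorm (x * alg_inv y))
          \<longleftrightarrow>
          (\<forall>x\<in>pos_def_cone. \<forall>y\<in>pos_def_cone.
             spectrum (\<phi> x * alg_inv (\<phi> y)) = spectrum (x * alg_inv y)))"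
  (is "(?i \<longleftrightarrow> ?ii) \<and> (?ii \<longleftrightarrow> ?iii)")
proof -
  \<comment> \<open>The implications form the cycle (i), (iii), (ii), (i).\<close>
  have "?iii" if "?i" using that spectrum_jordan_congruence[OF surj] by blast
  moreover have "?ii" if "?iii" using that by (simp add: spectral_seminorm_def)
  moreover have "?i" if "?ii"
    using that gauge_isometry_jordan[OF surj] unfolding gauge_ratio_def by metis
  ultimately show ?thesis by blast
qed

end
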